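(* Let $\mathbf{X}=(\mathbf{X}_1^\top,\mathbf{X}_2^\top)^\top\sim EC_{q+p}(\boldsymbol{\xi},\boldsymbol{\Omega},h^{(q+p)})$ with $\mathbf{X}_1\in\mathbb{R}^q$, $\mathbf{X}_2\in\mathbb{R}^p$, and let $\mathbf{Y}\sim TSLCT\text{-}EC_{p,q}(\boldsymbol{\xi},\boldsymbol{\Omega},h^{(q+p)},C(\mathbf{0});(\mathbf{a},\mathbf{b}))$ with selection subset $C(\mathbf{0})=\{\mathbf{x}_1\in\mathbb{R}^q:\mathbf{x}_1>\mathbf{0}\}$. Then for any measurable function $g:\mathbb{R}^p\to\mathbb{R}$, $$\mathbb{E}\left[g(\mathbf{Y})\,\frac{f_{\mathbf{X}_1}(\mathbf{0}\mid\mathbf{X}_2=\mathbf{Y})}{\mathbb{P}(\mathbf{X}_1>\mathbf{0}\mid\mathbf{X}_2=\mathbf{Y})}\right]=\frac{\mathbb{P}(\mathbf{a}\le\mathbf{W}_0\le\mathbf{b})}{\mathbb{P}(\mathbf{a}\le\mathbf{Y}_0\le\mathbf{b})}\,\frac{\mathbb{E}[g(\mathbf{W})]}{\mathbb{P}(\mathbf{X}_1\ge\mathbf{0})}\,f_{\mathbf{X}_1}(\mathbf{0}),$$ where $\mathbf{X}_1\sim EC_q(\boldsymbol{\xi}_1,\boldsymbol{\Omega}_{11},h^{(q)})$, $\mathbf{Y}_0\sim SLCT\text{-}EC_{p,q}(\boldsymbol{\xi},\boldsymbol{\Omega},h^{(q+p)},C(\mathbf{0}))$, $\mathbf{W}_0\sim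 EC_p(\boldsymbol{\xi}_2-\boldsymbol{\Omega}_{21}\boldsymbol{\Omega}_{11}^{-1}\boldsymbol{\xi}_1,\ \boldsymbol{\Omega}_{22}-\boldsymbol{\Omega}_{21}\boldsymbol{\Omega}_{11}^{-1}\boldsymbol{\Omega}_{12},\ h^{(p)}_{\mathbf{0}})$, and $\mathbf{W}\overset{d}{=}\mathbf{W}_0\mid(\mathbf{a}\le\mathbf{W}_0\le\mathbf{b})$.
   Context: Elliptical distribution: $\mathbf{X}\sim EC_{r}(\boldsymbol{\xi},\boldsymbol{\Omega},h^{(r)})$ means that $\mathbf{X}$ has density $|\boldsymbol{\Omega}|^{-1/2}h^{(r)}\big((\mathbf{x}-\boldsymbol{\xi})^\top\boldsymbol{\Omega}^{-1}(\mathbf{x}-\boldsymbol{\xi})\big)$ on $\mathbb{R}^r$, with $\boldsymbol{\Omega}$ positive definite. Here $\boldsymbol{\xi}=\begin{pmatrix}\boldsymbol{\xi}_1\\ \boldsymbol{\xi}_2\end{pmatrix}$, $\boldsymbol{\Omega}=\begin{pmatrix}\boldsymbol{\Omega}_{11}&\boldsymbol{\Omega}_{12}\\ \boldsymbol{\Omega}_{21}&\boldsymbol{\Omega}_{22}\end{pmatrix}$ are partitioned conformably with $(\mathbf{X}_1,\mathbf{X}_2)$, and $h^{(q)}$ is the generator of the ($q$-dimensional) marginal law. The conditional law of $\mathbf{X}_2$ given $\mathbf{X}_1=\mathbf{0}$ is $EC_p(\boldsymbol{\xi}_2-\boldsymbol{\Omega}_{21}\boldsymbol{\Omega}_{11}^{-1}\boldsymbol{\xi}_1,\boldsymbol{\Omega}_{22}-\boldsymbol{\Omega}_{21}\boldsymbol{\Omega}_{11}^{-1}\boldsymbol{\Omega}_{12},h^{(p)}_{\mathbf{0}})$,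 with conditional generator $h^{(p)}_{\mathbf{0}}(u)=h^{(q+p)}(u+\delta_1)/h^{(q)}(\delta_1)$, $\delta_1=\boldsymbol{\xi}_1^\top\boldsymbol{\Omega}_{11}^{-1}\boldsymbol{\xi}_1$; so $\mathbf{W}_0\overset{d}{=}\mathbf{X}_2\mid(\mathbf{X}_1=\mathbf{0})$. $f_{\mathbf{X}_1}$ is the density of $\mathbf{X}_1$ and $f_{\mathbf{X}_1}(\cdot\mid\mathbf{X}_2=\mathbf{y})$ is the conditional density (joint density divided by the marginal density of $\mathbf{X}_2$). $SLCT\text{-}EC_{p,q}(\boldsymbol{\xi},\boldsymbol{\Omega},h^{(q+p)},C)$ is the conditional law of $\mathbf{X}_2$ given $\mathbf{X}_1\in C$; $TSLCT\text{-}EC_{p,q}(\boldsymbol{\xi},\boldsymbol{\Omega},h^{(q+p)},C;(\mathbf{a},\mathbf{b}))$ is the law of $\mathbf{Y}_0\mid(\mathbf{a}\le\mathbf{Y}_0\le\mathbf{b})$ with $\mathbf{Y}_0\sim SLCT\text{-}EC_{p,q}(\boldsymbol{\xi},\boldsymbol{\Omega},h^{(q+p)},C)$, where $\mathbf{a},\mathbf{b}$ may have infinite entries. Vector inequalities are componentwise. It is understood that the conditioning events have positive probability, that $f_{\mathbf{X}_1}(\mathbf{0})>0$ (so that $\mathbf{W}_0$ is defined), and that $g$ is such that the expectations are defined. *)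

theory Defs
  imports "HOL-Probability.Probability"
begin

text \<open>
  Vectors of the partitioned space \<open>\<real>\<^sup>q\<^sup>+\<^sup>p\<close> are indexed by the sum type \<open>'q + 'p\<close>: the coordinates
  \<open>Inl i\<close> form the first block and the coordinates \<open>Inr j\<close> the second one.
\<close>

definition subvec :: "('k \<Rightarrow> 'n) \<Rightarrow> real ^ 'n \<Rightarrow> real ^ 'k" where
  "subvec s x = (\<chi> i. x $ s i)"

definition submat :: "('k \<Rightarrow> 'n) \<Rightarrow> ('l \<Rightarrow> 'n) \<Rightarrow> real ^ 'n ^ 'n \<Rightarrow> real ^ 'l ^ 'k" where
  "submat r s A = (\<chi> i j. A $ r i $ s j)"

abbreviation vec1 :: "real ^ ('q::finite + 'p::finite) \<Rightarrow> real ^ 'q" where "vec1 \<equiv> subvec Inl"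
abbreviation vec2 :: "real ^ ('q::finite + 'p::finite) \<Rightarrow> real ^ 'p" where "vec2 \<equiv> subvec Inr"
abbreviation mat11 :: "real ^ ('q::finite + 'p::finite) ^ ('q::finite + 'p::finite) \<Rightarrow> real ^ 'q ^ 'q" where "mat11 \<equiv> submat Inl Inl"
abbreviation mat12 :: "real ^ ('q::finite + 'p::finite) ^ ('q::finite + 'p::finite) \<Rightarrow> real ^ 'p ^ 'q" where "mat12 \<equiv> submat Inl Inr"
abbreviation mat21 :: "real ^ ('q::finite + 'p::finite) ^ ('q::finite + 'p::finite) \<Rightarrow> real ^ 'q ^ 'p" where "mat21 \<equiv> submat Inr Inl"
abbreviation mat22 :: "real ^ ('q::finite + 'p::finite) ^ ('q::finite + 'p::finite) \<Rightarrow> real ^ 'p ^ 'p" where "mat22 \<equiv> submat Inr Inr"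

definition stack :: "real ^ 'q \<Rightarrow> real ^ 'p \<Rightarrow> real ^ ('q::finite + 'p::finite)" where
  "stack x y = (\<chi> i. case i of Inl j \<Rightarrow> x $ j | Inr j \<Rightarrow> y $ j)"

definition pos_def_matrix :: "real ^ 'n ^ 'n \<Rightarrow> bool" where
  "pos_def_matrix A \<longleftrightarrow> transpose A = A \<and> (\<forall>x. x \<noteq> 0 \<longrightarrow> 0 < x \<bullet> (A *v x))"

definition EC_density ::
  "real ^ 'n \<Rightarrow> real ^ 'n ^ 'n \<Rightarrow> (real \<Rightarrow> real) \<Rightarrow> real ^ 'n \<Rightarrow> real" where
  "EC_density \<xi> \<Omega> h x = h ((x - \<xi>) \<bullet> (matrix_inv \<Omega> *v (x - \<xi>))) / sqrt (det \<Omega>)"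

definition EC :: "real ^ 'n \<Rightarrow> real ^ 'n ^ 'n \<Rightarrow> (real \<Rightarrow> real) \<Rightarrow> (real ^ 'n) measure" where
  "EC \<xi> \<Omega> h = density lborel (\<lambda>x. ennreal (EC_density \<xi> \<Omega> h x))"

text \<open>
  \<open>X \<sim> EC(\<xi>, \<Omega>, h)\<close>. Since \<open>ennreal\<close> truncates negative numbers, nonnegativity of the generator
  on \<open>[0, \<infinity>)\<close> is required explicitly; its values on negative arguments are irrelevant.
\<close>

definition elliptical ::
  "'m measure \<Rightarrow> ('m \<Rightarrow> real ^ 'n) \<Rightarrow> real ^ 'n \<Rightarrow> real ^ 'n ^ 'n \<Rightarrow> (real \<Rightarrow> real) \<Rightarrow> bool" where
  "elliptical M X \<xi> \<Omega> h \<longleftrightarrow>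
     prob_space M \<and> pos_def_matrix \<Omega> \<and> (\<forall>u\<ge>0. 0 \<le> h u) \<and>
     distributed M lborel X (\<lambda>x. ennreal (EC_density \<xi> \<Omega> h x))"

definition has_law :: "'m measure \<Rightarrow> ('m \<Rightarrow> real ^ 'n) \<Rightarrow> (real ^ 'n) measure \<Rightarrow> bool" where
  "has_law M X L \<longleftrightarrow> prob_space M \<and> X \<in> borel_measurable M \<and> distr M borel X = L"

text \<open>
  The generator of the marginal law obtained by integrating out \<open>'p\<close>-many coordinates of an
  elliptical vector with generator \<open>h\<close>. It is read off from the spherical case \<open>\<xi> = 0\<close>, \<open>\<Omega> = I\<close>,
  where \<open>\<parallel>x\<parallel>\<^sup>2 = \<parallel>x\<^sub>1\<parallel>\<^sup>2 + \<parallel>x\<^sub>2\<parallel>\<^sup>2\<close> with \<open>u = \<parallel>x\<^sub>1\<parallel>\<^sup>2\<close> and \<open>z = x\<^sub>2\<close>. Where the integral diverges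
  the value is \<open>0\<close>.
\<close>

definition marginal_generator :: "'p::finite itself \<Rightarrow> (real \<Rightarrow> real) \<Rightarrow> real \<Rightarrow> real" where
  "marginal_generator _ h u = (\<integral>z. h (u + z \<bullet> z) \<partial>(lborel :: (real ^ 'p) measure))"

definition conditional_generator ::
  "(real \<Rightarrow> real) \<Rightarrow> (real \<Rightarrow> real) \<Rightarrow> real \<Rightarrow> real \<Rightarrow> real" where
  "conditional_generator h hq \<delta> u = h (u + \<delta>) / hq \<delta>"

text \<open>
  For a joint density \<open>f\<close> on the partitioned space: the marginal density of the second block, the
  density at \<open>x\<close> of the first block given that the second one equals \<open>y\<close>, and the corresponding
  conditional probability of the event that the first block lies in \<open>C\<close>.
\<close>

definition marginal_density2 :: "(real ^ ('q::finite + 'p::finite) \<Rightarrow> real) \<Rightarrow> real ^ 'p \<Rightarrow> real" where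
  "marginal_density2 f y = (\<integral>x. f (stack x y) \<partial>lborel)"

definition cond_density1 :: "(real ^ ('q::finite + 'p::finite) \<Rightarrow> real) \<Rightarrow> real ^ 'p \<Rightarrow> real ^ 'q \<Rightarrow> real" where
  "cond_density1 f y x = f (stack x y) / marginal_density2 f y"

definition cond_prob1 :: "(real ^ ('q::finite + 'p::finite) \<Rightarrow> real) \<Rightarrow> real ^ 'p \<Rightarrow> (real ^ 'q) set \<Rightarrow> real" where
  "cond_prob1 f y C = set_lebesgue_integral lborel C (cond_density1 f y)"

text \<open>
  \<open>uniform_measure L A\<close> is the measure \<open>B \<mapsto> L (A \<inter> B) / L A\<close>, that is, \<open>L\<close> conditioned on \<open>A\<close>.
\<close>

definition SLCT_EC ::
  "real ^ ('q::finite + 'p::finite) \<Rightarrow> real ^ ('q::finite + 'p::finite) ^ ('q::finite + 'p::finite) \<Rightarrow> (real \<Rightarrow> real) \<Rightarrow> (real ^ 'q) set \<Rightarrow>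
   (real ^ 'p) measure" where
  "SLCT_EC \<xi> \<Omega> h C = distr (uniform_measure (EC \<xi> \<Omega> h) {x. vec1 x \<in> C}) borel vec2"

definition ebox :: "ereal ^ 'p \<Rightarrow> ereal ^ 'p \<Rightarrow> (real ^ 'p) set" where
  "ebox a b = {y. \<forall>i. a $ i \<le> ereal (y $ i) \<and> ereal (y $ i) \<le> b $ i}"

definition TSLCT_EC ::
  "real ^ ('q::finite + 'p::finite) \<Rightarrow> real ^ ('q::finite + 'p::finite) ^ ('q::finite + 'p::finite) \<Rightarrow> (real \<Rightarrow> real) \<Rightarrow> (real ^ 'q) set \<Rightarrow>
   ereal ^ 'p \<Rightarrow> ereal ^ 'p \<Rightarrow> (real ^ 'p) measure" where
  "TSLCT_EC \<xi> \<Omega> h C a b = uniform_measure (SLCT_EC \<xi> \<Omega> h C) (ebox a b)"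

text \<open>
  The library order satisfies \<open>x < y \<longleftrightarrow> x \<le> y \<and> \<not> y \<le> x\<close> on vectors, which is not the
  componentwise strict inequality, so the latter is spelled out.
\<close>

definition pos_orthant :: "(real ^ 'q) set" where
  "pos_orthant = {x. \<forall>i. 0 < x $ i}"

end

theory Submission
  imports Defs
begin

text \<open>
  Write \<open>\<phi> y = \<integral>\<^bsub>C\<^esub> f(x, y) dx\<close>. The law of \<open>Y\<^sub>0\<close> has density \<open>\<phi> / P(X\<^sub>1 \<in> C)\<close>, and the quotient of the
  conditional density at \<open>0\<close> by the conditional probability of \<open>C\<close> is \<open>f(0, y) / \<phi> y\<close>. Hence \<open>\<phi>\<close> cancels
  and the left-hand side becomes an integral of \<open>g y f(0, y)\<close> over the box, where \<open>f(0, y)\<close> is the density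
  of \<open>W\<^sub>0\<close> times \<open>f\<^bsub>X\<^sub>1\<^esub>(0)\<close>.

  The cancellation needs \<open>\<phi> y > 0\<close> for almost every \<open>y\<close> with \<open>f(0, y) > 0\<close>, which is not obvious because the
  generator \<open>h\<close> is only measurable. If \<open>\<phi> y = 0\<close>, then \<open>h\<close> vanishes almost everywhere on one side of the
  value \<open>u\<close> of the quadratic form at \<open>(0, y)\<close>, while \<open>h u > 0\<close>; the set of such \<open>u\<close> is null, and so is its
  preimage under a positive definite quadratic form.
\<close>

subsection \<open>Linear change of variables\<close>

text \<open>The exceptional null set of \<open>y\<close> is genuine. If \<open>h\<close> is
  supported on \<open>[0, 1]\<close> apart from one larger value \<open>u\<close>, then points
  \<open>y\<close> at which the form at \<open>(0, y)\<close> equals \<open>u\<close> have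
  \<open>f(0, y) > 0\<close>, while \<open>\<phi> y\<close> may be \<open>0\<close> and the quotient
  is then \<open>0\<close> by the convention for division. No argument for an individual
  \<open>y\<close> can exclude this. Only one side of \<open>u\<close> is controlled because the
  orthant is a cone with apex \<open>0\<close>: on a ray the form is a nonconstant quadratic
  polynomial starting at \<open>u\<close>, and its initial slope may have either sign. The constants
  are matched by block elimination. With the Schur complement, the form at \<open>(x, y)\<close> is
  a form in \<open>x\<close> plus a form in \<open>y\<close> centred at a linear function of
  \<open>x\<close>. This single identity yields the marginal law of the first block, the density of
  the conditional law at \<open>0\<close> and, by comparing volumes, the factorisation of the
  determinant.\<close>

text \<open>The library versions in \<open>Change_Of_Vars\<close> require a well-ordered index type, which sums
  \<open>'q + 'p\<close> of arbitrary finite types are not.\<close>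

lemma nn_integral_lborel_translate:
  fixes f :: "'a::euclidean_space \<Rightarrow> ennreal"
  assumes [measurable]: "f \<in> borel_measurable borel"
  shows "(\<integral>\<^sup>+x. f (c + x) \<partial>lborel) = (\<integral>\<^sup>+x. f x \<partial>lborel)"
proof -
  have "(\<integral>\<^sup>+x. f x \<partial>lborel) = (\<integral>\<^sup>+x. f x \<partial>distr lborel borel ((+) c))"
    by (simp add: lborel_distr_plus)
  also have "\<dots> = (\<integral>\<^sup>+x. f (c + x) \<partial>lborel)"
    by (rule nn_integral_distr) auto
  finally show ?thesis by simp
qed

lemma nn_integral_lborel_reflect:
  fixes f :: "'a::euclidean_space \<Rightarrow> ennreal"
  assumes [measurable]: "f \<in> borel_measurable borel"
  shows "(\<integral>\<^sup>+x. f (c - x) \<partial>lborel) = (\<integral>\<^sup>+x. f x \<partial>lborel)"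
  by (subst (2) lborel_affine[of "-1" c]) (simp_all add: nn_integral_distr density_1)

text \<open>Uniqueness of Haar measure for the pushforward of \<open>lborel\<close> under \<open>T\<close>, with the constant eliminated.\<close>

lemma nn_integral_linear_proportional:
  fixes f g :: "'a::euclidean_space \<Rightarrow> ennreal"
  assumes [measurable]: "f \<in> borel_measurable borel" "g \<in> borel_measurable borel"
    and lin: "linear (T :: 'a \<Rightarrow> 'a)" and inv: "\<And>y. T (T' y) = y"
  shows "(\<integral>\<^sup>+x. f (T x) \<partial>lborel) * (\<integral>\<^sup>+x. g x \<partial>lborel) =
         (\<integral>\<^sup>+x. g (T x) \<partial>lborel) * (\<integral>\<^sup>+x. f x \<partial>lborel)"
proof -
  have [measurable]: "T \<in> borel_measurable borel"
    using lin by (intro borel_measurable_continuous_onI linear_continuous_on linear_conv_bounded_linear[THEN iffD1])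
  have "(\<integral>\<^sup>+x. f (T x) \<partial>lborel) * (\<integral>\<^sup>+y. g y \<partial>lborel) =
        (\<integral>\<^sup>+x. f (T x) * (\<integral>\<^sup>+y. g (T x + y) \<partial>lborel) \<partial>lborel)"
    by (simp add: nn_integral_lborel_translate nn_integral_multc)
  also have "\<dots> = (\<integral>\<^sup>+x. (\<integral>\<^sup>+y. f (T x) * g (T x + y) \<partial>lborel) \<partial>lborel)"
    by (simp add: nn_integral_cmult)
  also have "\<dots> = (\<integral>\<^sup>+y. (\<integral>\<^sup>+x. f (T x) * g (T x + y) \<partial>lborel) \<partial>lborel)"
    by (rule lborel_pair.Fubini') measurable
  \<comment> \<open>Replacing \<open>x\<close> by \<open>x - T' y\<close> moves the shift from the
    argument of \<open>g\<close> to that of \<open>f\<close>; the right inverse of \<open>T\<close>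
    makes this translation available. Reflecting \<open>y\<close> then isolates the integral of
    \<open>f\<close>.\<close>
  also have "\<dots> = (\<integral>\<^sup>+y. (\<integral>\<^sup>+x. f (T x - y) * g (T x) \<partial>lborel) \<partial>lborel)"
  proof (rule nn_integral_cong)
    fix y
    have "(\<integral>\<^sup>+x. f (T x) * g (T x + y) \<partial>lborel) = (\<integral>\<^sup>+x. f (T (- T' y + x)) * g (T (- T' y + x) + y) \<partial>lborel)"
      by (rule nn_integral_lborel_translate[symmetric]) measurable
    moreover have "T (- T' y + x) = T x - y" for x
      by (simp add: linear_diff[OF lin] inv)
    ultimately show "(\<integral>\<^sup>+x. f (T x) * g (T x + y) \<partial>lborel) = (\<integral>\<^sup>+x. f (T x - y) * g (T x) \<partial>lborel)"
      by simp
  qed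
  also have "\<dots> = (\<integral>\<^sup>+x. (\<integral>\<^sup>+y. f (T x - y) * g (T x) \<partial>lborel) \<partial>lborel)"
    by (rule lborel_pair.Fubini') measurable
  also have "\<dots> = (\<integral>\<^sup>+x. g (T x) * (\<integral>\<^sup>+y. f y \<partial>lborel) \<partial>lborel)"
    by (intro nn_integral_cong, subst nn_integral_multc) (simp_all add: nn_integral_lborel_reflect mult.commute)
  also have "\<dots> = (\<integral>\<^sup>+x. g (T x) \<partial>lborel) * (\<integral>\<^sup>+x. f x \<partial>lborel)"
    by (simp add: nn_integral_multc)
  finally show ?thesis .
qed


text \<open>The unit ball is the test set that fixes the factor in
  \<open>nn_integral_linear_proportional\<close>; these two facts allow its measure to be cancelled
  in \<open>ennreal\<close>.\<close>

lemma emeasure_unit_ball_pos_finite: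
  "emeasure lborel (ball (0::'a::euclidean_space) 1) \<noteq> 0"
  "emeasure lborel (ball (0::'a::euclidean_space) 1) \<noteq> \<top>"
proof -
  have "measure lborel (ball (0::'a) 1) > 0"
    by (simp add: content_ball_pos)
  then show "emeasure lborel (ball (0::'a::euclidean_space) 1) \<noteq> 0"
    by (auto simp: measure_def)
  show "emeasure lborel (ball (0::'a::euclidean_space) 1) \<noteq> \<top>"
    using emeasure_bounded_finite[of "ball (0::'a) 1"] by simp
qed

text \<open>The unit ball is invariant under \<open>T\<close>, so testing proportionality on its
  indicator gives the factor \<open>1\<close>.\<close>

lemma nn_integral_lborel_orthogonal:
  fixes f :: "'a::euclidean_space \<Rightarrow> ennreal"
  assumes T: "orthogonal_transformation (T :: 'a \<Rightarrow> 'a)" and [measurable]: "f \<in> borel_measurable borel"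
  shows "(\<integral>\<^sup>+x. f (T x) \<partial>lborel) = (\<integral>\<^sup>+x. f x \<partial>lborel)"
proof -
  let ?B = "ball (0::'a) 1"
  have "(\<integral>\<^sup>+x. f (T x) \<partial>lborel) * (\<integral>\<^sup>+x. indicator ?B x \<partial>lborel) =
        (\<integral>\<^sup>+x. indicator ?B (T x) \<partial>lborel) * (\<integral>\<^sup>+x. f x \<partial>lborel)"
    using T by (intro nn_integral_linear_proportional[where T' = "inv T"])
      (auto intro!: borel_measurable_indicator simp: orthogonal_transformation_linear surj_f_inv_f[OF orthogonal_transformation_surj])
  moreover have "indicator ?B (T x) = (indicator ?B x :: ennreal)" for x
    using T by (simp add: indicator_def orthogonal_transformation_norm)
  ultimately show ?thesis
    using emeasure_unit_ball_pos_finite[where 'a='a]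
    by (simp add: mult.commute[of _ "emeasure _ _"] ennreal_mult_cancel_left)
qed

lemma abs_det_orthogonal:
  fixes T :: "real ^ 'n \<Rightarrow> real ^ 'n"
  assumes "orthogonal_transformation T"
  shows "\<bar>det (matrix T)\<bar> = 1"
  using assms det_orthogonal_matrix[of "matrix T"] by (auto simp: orthogonal_transformation_matrix)

text \<open>The scaling argument for shears ends in an equality of squares of integrals in
  \<open>ennreal\<close>.\<close>

lemma ennreal_square_cancel:
  fixes a b :: ennreal
  assumes "a * a = b * b" shows "a = b"
proof -
  have "False" if "a * a = b * b" "a < b" for a b :: ennreal
  proof -
    have "a * a \<le> a * b" and "a * b \<le> b * b"
      using that(2) by (auto intro!: mult_mono)
    with that(1) have eq: "a * b = b * b" by simp
    have "b \<noteq> 0" "a \<noteq> \<top>" using that(2) by auto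
    moreover have "b \<noteq> \<top>" using that by (auto simp: ennreal_mult_eq_top_iff top_unique)
    ultimately show False
      using eq that(2) by (simp add: mult.commute[of a] ennreal_mult_cancel_left)
  qed
  with assms show ?thesis
    by (metis linorder_neqE)
qed

text \<open>Flipping the sign of coordinate \<open>n\<close> conjugates the shear to its inverse, so neither its
  determinant nor its scaling factor can differ from \<open>1\<close> in absolute value.\<close>

lemma shear_preserves_lborel:
  fixes m n :: "'n::finite"
  defines "T \<equiv> \<lambda>x::real^'n. \<chi> i. if i = m then x$m + x$n else x$i"
  assumes mn: "m \<noteq> n" and [measurable]: "f \<in> borel_measurable borel"
  shows "\<bar>det (matrix T)\<bar> = 1" and "(\<integral>\<^sup>+x. f (T x) \<partial>lborel) = (\<integral>\<^sup>+x. f x \<partial>lborel)"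
proof -
  define D where "D = (\<lambda>x::real^'n. \<chi> i. if i = n then - x$n else x$i)"
  let ?B = "ball (0::real^'n) 1"
  have linT: "linear T" and linD: "linear D"
    by (auto intro!: linearI simp: T_def D_def vec_eq_iff algebra_simps)
  have orthD: "orthogonal_transformation D"
    unfolding orthogonal_transformation
    using linD by (auto simp: D_def norm_vec_def L2_set_def intro!: sum.cong arg_cong[where f=sqrt])
  have TD: "T (D (T (D x))) = x" for x
    using mn by (auto simp: T_def D_def vec_eq_iff)
  then have "T \<circ> D \<circ> (T \<circ> D) = id"
    by auto
  then have "matrix (T \<circ> D) ** matrix (T \<circ> D) = mat 1"
    using linT linD by (metis linear_compose matrix_compose matrix_id_mat_1)
  then have *: "matrix T ** matrix D ** (matrix T ** matrix D) = mat 1"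
    by (simp only: matrix_compose[OF linD linT])
  have "det (matrix T ** matrix D ** (matrix T ** matrix D)) = 1"
    by (simp add: *)
  then have "det (matrix T) * det (matrix T) * (det (matrix D) * det (matrix D)) = 1"
    by (simp add: det_mul mult_ac)
  moreover have "det (matrix D) * det (matrix D) = 1"
    using abs_det_orthogonal[OF orthD] by (metis abs_mult_self_eq mult.right_neutral)
  ultimately have "\<bar>det (matrix T)\<bar>\<^sup>2 = 1"
    by (simp add: power2_eq_square)
  then show "\<bar>det (matrix T)\<bar> = 1"
    by (auto simp: power2_eq_1_iff)
  have [measurable]: "T \<in> borel_measurable borel" "D \<in> borel_measurable borel"
    using linT linD
    by (auto intro!: borel_measurable_continuous_onI linear_continuous_on simp: linear_conv_bounded_linear)
  have [measurable]: "?B \<in> sets borel" by simp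
  let ?I = "\<lambda>g::real^'n \<Rightarrow> ennreal. \<integral>\<^sup>+x. g x \<partial>lborel"
  let ?b = "indicator ?B :: real^'n \<Rightarrow> ennreal"
  have scale: "?I (\<lambda>x. g (T x)) * ?I ?b = ?I (\<lambda>x. ?b (T x)) * ?I g" if "g \<in> borel_measurable borel" for g
    using that linT TD by (intro nn_integral_linear_proportional[where T' = "\<lambda>x. D (T (D x))"])
      (auto intro!: borel_measurable_indicator)
  \<comment> \<open>Apply \<open>scale\<close> to \<open>?b\<close> composed with
    \<open>D \<circ> T \<circ> D\<close>, the inverse of \<open>T\<close>. Since \<open>D\<close>
    preserves both integrals and the ball, each side becomes a square.\<close>
  have "?I ?b * ?I ?b = ?I (\<lambda>x. ?b (D (T (D (T x))))) * ?I ?b"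
  proof -
    have "D (T (D (T x))) = x" for x
      using mn by (auto simp: T_def D_def vec_eq_iff)
    then show ?thesis by simp
  qed
  also have "\<dots> = ?I (\<lambda>x. ?b (T x)) * ?I (\<lambda>x. ?b (D (T (D x))))"
    by (rule scale) measurable
  also have "?I (\<lambda>x. ?b (D (T (D x)))) = ?I (\<lambda>x. ?b (D (T x)))"
    by (rule nn_integral_lborel_orthogonal[OF orthD]) measurable
  also have "\<dots> = ?I (\<lambda>x. ?b (T x))"
    using orthD by (simp add: indicator_def orthogonal_transformation_norm)
  finally have "?I (\<lambda>x. ?b (T x)) = ?I ?b"
    by (metis ennreal_square_cancel)
  then show "(\<integral>\<^sup>+x. f (T x) \<partial>lborel) = (\<integral>\<^sup>+x. f x \<partial>lborel)"
    using scale[of f] emeasure_unit_ball_pos_finite[where 'a="real^'n"]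
    by (simp add: mult.commute[of _ "emeasure _ _"] ennreal_mult_cancel_left)
qed

lemma prod_Basis_cart: "(\<Prod>b\<in>(Basis :: (real ^ 'n) set). f b) = (\<Prod>i\<in>UNIV. f (axis i 1))"
proof -
  have Basis: "(Basis :: (real ^ 'n) set) = range (\<lambda>i. axis i 1)"
    by (auto simp: Basis_vec_def)
  have inj: "inj (\<lambda>i::'n. axis i (1::real))"
    by (auto simp: inj_on_def axis_eq_axis)
  show ?thesis
    unfolding Basis by (simp add: prod.reindex[OF inj])
qed

lemma borel_measurable_matrix_vector_mult [measurable (raw)]:
  fixes A :: "real ^ 'n ^ 'm"
  assumes [measurable]: "f \<in> borel_measurable M"
  shows "(\<lambda>x. A *v f x) \<in> borel_measurable M"
  by (rule measurable_compose[OF assms])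
     (intro borel_measurable_continuous_onI matrix_vector_mult_linear_continuous_on)

lemma nn_integral_lborel_stretch:
  fixes c :: "'n::finite \<Rightarrow> real"
  assumes c: "\<And>i. c i \<noteq> 0" and [measurable]: "f \<in> borel_measurable borel"
  shows "(\<integral>\<^sup>+x. f x \<partial>lborel) = ennreal \<bar>prod c UNIV\<bar> * (\<integral>\<^sup>+x. f (\<chi> i. c i * x $ i) \<partial>lborel)"
proof -
  \<comment> \<open>\<open>lborel_affine_euclidean\<close> indexes its factors by basis vectors;
    \<open>c'\<close> reads the factor \<open>c i\<close> off the vector
    \<open>axis i 1\<close>.\<close>
  define c' where "c' b = (\<Sum>i\<in>UNIV. c i * (b $ i))" for b :: "real^'n"
  have c': "c' (axis i 1) = c i" for i
    by (simp add: c'_def axis_def if_distrib cong: if_cong)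
  have Basis: "(Basis :: (real^'n) set) = range (\<lambda>i. axis i 1)"
    by (auto simp: Basis_vec_def)
  have inj: "inj (\<lambda>i::'n. axis i (1::real))"
    by (auto simp: inj_on_def axis_eq_axis)
  have eq: "0 + (\<Sum>j\<in>Basis. (c' j * (x \<bullet> j)) *\<^sub>R j) = (\<chi> i. c i * x $ i)" for x
    unfolding Basis
    by (subst sum.reindex[OF inj])
       (simp only: o_def c' inner_axis, simp add: vec_eq_iff axis_def if_distrib cong: if_cong)
  have meas [measurable]: "(\<lambda>x::real^'n. \<chi> i. c i * x $ i) \<in> borel_measurable borel"
    by (intro borel_measurable_continuous_onI continuous_on_vec_lambda continuous_intros)
  have "lborel = density (distr lborel borel (\<lambda>x. 0 + (\<Sum>j\<in>Basis. (c' j * (x \<bullet> j)) *\<^sub>R j)))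
     (\<lambda>_. (\<Prod>j\<in>Basis. \<bar>c' j\<bar>))"
    by (rule lborel_affine_euclidean) (use c in \<open>auto simp: Basis c'\<close>)
  also have "\<dots> = density (distr lborel borel (\<lambda>x. \<chi> i. c i * x $ i)) (\<lambda>_. ennreal \<bar>prod c UNIV\<bar>)"
    unfolding eq by (simp add: prod_Basis_cart c' abs_prod)
  finally have *: "lborel = \<dots>" .
  show ?thesis
    by (subst *) (simp add: nn_integral_density nn_integral_distr nn_integral_cmult)
qed

text \<open>Every linear map is composed of elementary ones, and both the determinant and the
  scaling factor are multiplicative. The determinant condition sits inside \<open>P\<close>, so that
  singular elementary maps satisfy it vacuously.\<close>

theorem nn_integral_lborel_linear:
  fixes T :: "real ^ 'n \<Rightarrow> real ^ 'n"
  assumes "linear T" and "det (matrix T) \<noteq> 0" and "f \<in> borel_measurable borel"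
  shows "(\<integral>\<^sup>+x. f x \<partial>lborel) = ennreal \<bar>det (matrix T)\<bar> * (\<integral>\<^sup>+x. f (T x) \<partial>lborel)"
proof -
  define P where "P T \<longleftrightarrow> (det (matrix T) \<noteq> 0 \<longrightarrow> (\<forall>f\<in>borel_measurable borel.
      (\<integral>\<^sup>+x. f x \<partial>lborel) = ennreal \<bar>det (matrix T)\<bar> * (\<integral>\<^sup>+x. f (T x) \<partial>lborel)))"
    for T :: "real ^ 'n \<Rightarrow> real ^ 'n"
  have "P T"
    using \<open>linear T\<close>
  proof (rule induct_linear_elementary)
    fix f g assume comp: "linear f" "linear g" "P f" "P g"
    show "P (f \<circ> g)"
      unfolding P_def
    proof (intro impI ballI)
      fix \<phi> :: "real ^ 'n \<Rightarrow> ennreal" assume [measurable]: "\<phi> \<in> borel_measurable borel"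
      have [measurable]: "f \<in> borel_measurable borel"
        using comp(1) by (auto intro!: borel_measurable_continuous_onI linear_continuous_on simp: linear_conv_bounded_linear)
      assume "det (matrix (f \<circ> g)) \<noteq> 0"
      then have "det (matrix f) \<noteq> 0" "det (matrix g) \<noteq> 0"
        using comp by (auto simp: matrix_compose det_mul)
      with comp(3,4) have
        f: "\<And>\<phi>. \<phi> \<in> borel_measurable borel \<Longrightarrow>
          (\<integral>\<^sup>+x. \<phi> x \<partial>lborel) = ennreal \<bar>det (matrix f)\<bar> * (\<integral>\<^sup>+x. \<phi> (f x) \<partial>lborel)" and
        g: "\<And>\<phi>. \<phi> \<in> borel_measurable borel \<Longrightarrow>
          (\<integral>\<^sup>+x. \<phi> x \<partial>lborel) = ennreal \<bar>det (matrix g)\<bar> * (\<integral>\<^sup>+x. \<phi> (g x) \<partial>lborel)"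
        unfolding P_def by blast+
      have "(\<integral>\<^sup>+x. \<phi> x \<partial>lborel) = ennreal \<bar>det (matrix f)\<bar> * (\<integral>\<^sup>+x. \<phi> (f x) \<partial>lborel)"
        by (rule f) measurable
      also have "(\<integral>\<^sup>+x. \<phi> (f x) \<partial>lborel) = ennreal \<bar>det (matrix g)\<bar> * (\<integral>\<^sup>+x. \<phi> (f (g x)) \<partial>lborel)"
        by (rule g) measurable
      finally show "(\<integral>\<^sup>+x. \<phi> x \<partial>lborel) = ennreal \<bar>det (matrix (f \<circ> g))\<bar> * (\<integral>\<^sup>+x. \<phi> ((f \<circ> g) x) \<partial>lborel)"
        using comp(1,2) by (simp add: matrix_compose det_mul abs_mult ennreal_mult mult.assoc)
    qed
  next
    fix f :: "real^'n \<Rightarrow> real^'n" and i assume zeroes: "linear f" "\<And>x. f x $ i = 0"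
    then have "row i (matrix f) = 0"
      by (simp add: row_def matrix_def vec_eq_iff)
    then show "P f"
      unfolding P_def by (simp add: det_zero_row)
  next
    fix c :: "'n \<Rightarrow> real"
    have mc: "matrix (\<lambda>x. \<chi> i. c i * x $ i) = (\<chi> i j. if i = j then c i else 0)"
      by (auto simp: matrix_def axis_def vec_eq_iff)
    have "det (matrix (\<lambda>x. \<chi> i. c i * x $ i)) = prod c UNIV"
      unfolding mc by (subst det_diagonal) auto
    then show "P (\<lambda>x. \<chi> i. c i * x $ i)"
      unfolding P_def by (auto intro!: nn_integral_lborel_stretch)
  next
    fix m n :: 'n
    let ?S = "\<lambda>x::real^'n. \<chi> i. x $ Transposition.transpose m n i"
    have "(\<Sum>i\<in>UNIV. (x $ Transposition.transpose m n i)\<^sup>2) = (\<Sum>i\<in>UNIV. (x $ i)\<^sup>2)" for x :: "real^'n"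
      by (intro sum.reindex_bij_betw) auto
    then have "orthogonal_transformation ?S"
      unfolding orthogonal_transformation
      by (auto intro!: linearI simp: norm_vec_def L2_set_def vec_eq_iff)
    then show "P ?S"
      using abs_det_orthogonal[of ?S] nn_integral_lborel_orthogonal[of ?S] by (simp add: P_def)
  next
    fix m n :: 'n assume "m \<noteq> n"
    then show "P (\<lambda>x. \<chi> i. if i = m then x $ m + x $ n else x $ i)"
      unfolding P_def by (simp add: shear_preserves_lborel)
  qed
  with assms show ?thesis by (simp add: P_def)
qed

subsection \<open>Positive definite matrices\<close>

lemma matrix_mult_nth: "(A ** B) $ i $ j = row i A \<bullet> column j B" for A :: "real ^ 'n ^ 'm"
  by (simp add: row_def column_def matrix_matrix_mult_def inner_vec_def)

lemma column_matrix_mult: "column k (A ** B) = A *v column k B"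
  by (simp add: column_def matrix_matrix_mult_def matrix_vector_mult_def)

lemma pos_def_matrix_symmetric:
  assumes "pos_def_matrix A"
  shows "x \<bullet> (A *v y) = (A *v x) \<bullet> y"
  using assms unfolding pos_def_matrix_def by (metis dot_lmul_matrix vector_transpose_matrix)

lemma pos_def_matrix_invertible:
  assumes "pos_def_matrix A"
  shows "invertible A"
proof -
  have "x = 0" if "A *v x = 0" for x
    using assms that unfolding pos_def_matrix_def by (metis inner_zero_right less_irrefl)
  then show ?thesis
    by (simp add: invertible_left_inverse matrix_left_invertible_ker)
qed

lemma matrix_inv_inverse:
  assumes "invertible (A :: real ^ 'n ^ 'n)"
  shows matrix_inv_right: "A ** matrix_inv A = mat 1" and matrix_inv_left: "matrix_inv A ** A = mat 1"
  using assms unfolding invertible_def matrix_inv_def by (metis (mono_tags, lifting) someI_ex)+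

lemma matrix_inv_vector_cancel:
  assumes "invertible (A :: real ^ 'n ^ 'n)"
  shows "A *v (matrix_inv A *v x) = x" and "matrix_inv A *v (A *v x) = x"
  using assms by (simp_all add: matrix_vector_mul_assoc matrix_inv_right matrix_inv_left)

lemma pos_def_matrix_inv:
  fixes A :: "real ^ 'n ^ 'n"
  assumes A: "pos_def_matrix A"
  shows "pos_def_matrix (matrix_inv A)"
  unfolding pos_def_matrix_def
proof (intro conjI allI impI)
  note inv = pos_def_matrix_invertible[OF A]
  have "transpose (matrix_inv A) ** A = mat 1"
    using A inv unfolding pos_def_matrix_def
    by (metis matrix_inv_right matrix_transpose_mul transpose_mat)
  then show "transpose (matrix_inv A) = matrix_inv A"
    using inv by (metis matrix_inv_right matrix_mul_assoc matrix_mul_lid matrix_mul_rid)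
next
  fix x :: "real ^ 'n" assume "x \<noteq> 0"
  note inv = matrix_inv_vector_cancel[OF pos_def_matrix_invertible[OF A], of x]
  let ?v = "matrix_inv A *v x"
  have "?v \<noteq> 0" using \<open>x \<noteq> 0\<close> inv by force
  then have "0 < ?v \<bullet> (A *v ?v)"
    using A by (auto simp: pos_def_matrix_def)
  then show "0 < x \<bullet> (matrix_inv A *v x)"
    by (simp add: inv inner_commute)
qed

text \<open>Gram-Schmidt for the inner product \<open>u \<bullet> (P *v v)\<close>. Fewer images
  \<open>P *v u\<close> than the dimension leave a nonzero vector that is orthogonal to them in the
  Euclidean sense, hence orthogonal to each \<open>u\<close> for the new inner product.\<close>

lemma pos_def_matrix_orthonormal_family:
  fixes P :: "real ^ 'n ^ 'n"
  assumes P: "pos_def_matrix P"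
  shows "k \<le> CARD('n) \<Longrightarrow>
    \<exists>B. finite B \<and> card B = k \<and> (\<forall>u\<in>B. \<forall>v\<in>B. u \<bullet> (P *v v) = of_bool (u = v))"
proof (induction k)
  case 0
  show ?case by (intro exI[of _ "{}"]) simp
next
  case (Suc k)
  then obtain B where B: "finite B" "card B = k" "\<forall>u\<in>B. \<forall>v\<in>B. u \<bullet> (P *v v) = of_bool (u = v)"
    by auto
  have "dim ((*v) P ` B) \<le> card ((*v) P ` B)"
    using B by (intro dim_le_card') simp
  also have "\<dots> < DIM(real^'n)"
    using B Suc.prems card_image_le[OF B(1), of "(*v) P"] by simp
  finally obtain x where x: "x \<noteq> 0" "\<And>y. y \<in> span ((*v) P ` B) \<Longrightarrow> orthogonal x y"
    using orthogonal_to_subspace_exists by blast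
  have xB: "x \<bullet> (P *v u) = 0" if "u \<in> B" for u
    using x(2)[of "P *v u"] that by (auto simp: orthogonal_def span_base)
  have pos: "0 < x \<bullet> (P *v x)"
    using P x(1) by (auto simp: pos_def_matrix_def)
  define e where "e = (1 / sqrt (x \<bullet> (P *v x))) *\<^sub>R x"
  have eB: "e \<bullet> (P *v u) = 0" "u \<bullet> (P *v e) = 0" if "u \<in> B" for u
    using xB[OF that] pos_def_matrix_symmetric[OF P, of u x]
    by (simp_all add: e_def matrix_vector_mult_scaleR inner_commute)
  have ee: "e \<bullet> (P *v e) = 1"
    using pos by (simp add: e_def matrix_vector_mult_scaleR divide_simps)
  have "e \<notin> B" using eB ee by force
  then show ?case
    using B eB ee by (intro exI[of _ "insert e B"]) auto
qed

text \<open>The columns of \<open>E\<close> form an orthonormal basis for the inner product of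
  \<open>P\<close>; \<open>E\<close> does the work of an inverse square root of \<open>P\<close>
  without spectral theory.\<close>

lemma pos_def_matrix_congruent_identity:
  fixes P :: "real ^ 'n ^ 'n"
  assumes P: "pos_def_matrix P"
  obtains E :: "real ^ 'n ^ 'n" where "transpose E ** (P ** E) = mat 1"
proof -
  obtain B where B: "finite B" "card B = CARD('n)" "\<forall>u\<in>B. \<forall>v\<in>B. u \<bullet> (P *v v) = of_bool (u = v)"
    using pos_def_matrix_orthonormal_family[OF P, of "CARD('n)"] by auto
  obtain b where b: "bij_betw b (UNIV :: 'n set) B"
    using finite_same_card_bij[of "UNIV :: 'n set" B] B by auto
  define E where "E = (\<chi> i j. b j $ i)"
  have col: "column j E = b j" "row j (transpose E) = b j" for j
    by (simp_all add: E_def column_def row_def transpose_def vec_eq_iff)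
  have "b j \<bullet> (P *v b k) = of_bool (j = k)" for j k
    using B(3) b by (auto simp: bij_betw_def inj_eq)
  then have "transpose E ** (P ** E) = mat 1"
    by (simp add: matrix_mult_nth[of "transpose E"] column_matrix_mult col mat_def vec_eq_iff)
  then show ?thesis by (rule that)
qed

text \<open>Taking determinants in the congruence shows that the substitution
  \<open>x = E *v z\<close>, which makes the form spherical, has Jacobian
  \<open>sqrt (det \<Omega>)\<close>, the normalising constant of \<open>EC_density\<close>.\<close>

lemma pos_def_matrix_inv_congruent_identity:
  fixes \<Omega> :: "real ^ 'n ^ 'n"
  assumes \<Omega>: "pos_def_matrix \<Omega>"
  obtains E :: "real ^ 'n ^ 'n"
  where "transpose E ** (matrix_inv \<Omega> ** E) = mat 1" "det E \<noteq> 0" "det \<Omega> = (det E)\<^sup>2"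
proof -
  let ?P = "matrix_inv \<Omega>"
  obtain E :: "real ^ 'n ^ 'n" where E: "transpose E ** (?P ** E) = mat 1"
    by (rule pos_def_matrix_congruent_identity[OF pos_def_matrix_inv[OF \<Omega>]])
  have "det (transpose E ** (?P ** E)) = 1"
    by (simp add: E)
  then have 1: "det E * det E * det ?P = 1"
    by (simp add: det_mul mult_ac)
  have "det ?P * det \<Omega> = det (?P ** \<Omega>)"
    by (simp add: det_mul)
  also have "\<dots> = 1"
    using pos_def_matrix_invertible[OF \<Omega>] by (simp add: matrix_inv_left)
  finally have 2: "det ?P * det \<Omega> = 1" .
  have "det \<Omega> = (det E)\<^sup>2"
    using 1 2 by (metis mult.commute mult.left_commute mult.right_neutral power2_eq_square)
  moreover have "det E \<noteq> 0" using 1 by auto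
  ultimately show ?thesis using E that by blast
qed

lemma det_pos_def_matrix: "pos_def_matrix \<Omega> \<Longrightarrow> 0 < det \<Omega>"
  by (erule pos_def_matrix_inv_congruent_identity) simp

lemma nn_integral_quadratic_form:
  fixes \<Omega> :: "real ^ 'n ^ 'n" and F :: "real \<Rightarrow> ennreal"
  assumes \<Omega>: "pos_def_matrix \<Omega>" and [measurable]: "F \<in> borel_measurable borel"
  shows "(\<integral>\<^sup>+x. F (x \<bullet> (matrix_inv \<Omega> *v x)) \<partial>lborel) =
    ennreal (sqrt (det \<Omega>)) * (\<integral>\<^sup>+z. F (z \<bullet> z) \<partial>(lborel :: (real ^ 'n) measure))"
proof -
  let ?P = "matrix_inv \<Omega>"
  obtain E :: "real ^ 'n ^ 'n" where E: "transpose E ** (?P ** E) = mat 1"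
    and "det E \<noteq> 0" and det: "det \<Omega> = (det E)\<^sup>2"
    by (rule pos_def_matrix_inv_congruent_identity[OF \<Omega>])
  have qf: "(E *v z) \<bullet> (?P *v (E *v z)) = z \<bullet> z" for z
  proof -
    have "(E *v z) \<bullet> (?P *v (E *v z)) = z \<bullet> (transpose E *v (?P *v (E *v z)))"
      by (metis dot_lmul_matrix vector_transpose_matrix)
    also have "transpose E *v (?P *v (E *v z)) = z"
      using E by (simp only: matrix_vector_mul_assoc matrix_vector_mul_lid)
    finally show ?thesis .
  qed
  have "(\<integral>\<^sup>+x. F (x \<bullet> (?P *v x)) \<partial>lborel) =
      ennreal \<bar>det (matrix ((*v) E))\<bar> * (\<integral>\<^sup>+z. F ((E *v z) \<bullet> (?P *v (E *v z))) \<partial>lborel)"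
    using \<open>det E \<noteq> 0\<close> by (intro nn_integral_lborel_linear) auto
  then show ?thesis
    by (simp add: qf det)
qed

subsection \<open>Partitioned vectors\<close>

lemma stack_nth [simp]: "stack x y $ Inl i = x $ i" "stack x y $ Inr j = y $ j"
  by (simp_all add: stack_def)

lemma vec_stack [simp]: "vec1 (stack x y) = x" "vec2 (stack x y) = y"
  by (simp_all add: subvec_def vec_eq_iff)

lemma stack_vec [simp]: "stack (vec1 w) (vec2 w) = w"
  by (simp add: stack_def subvec_def vec_eq_iff split: sum.split)

lemma stack_diff: "stack x y - w = stack (x - vec1 w) (y - vec2 w)"
  by (simp add: stack_def subvec_def vec_eq_iff split: sum.split)

lemma sum_UNIV_Plus:
  "(\<Sum>i\<in>(UNIV :: ('q::finite + 'p::finite) set). f i) = (\<Sum>i\<in>UNIV. f (Inl i)) + (\<Sum>j\<in>UNIV. f (Inr j))"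
  by (simp flip: UNIV_Plus_UNIV add: sum.Plus)

lemma prod_UNIV_Plus:
  "(\<Prod>i\<in>(UNIV :: ('q::finite + 'p::finite) set). f i) = (\<Prod>i\<in>UNIV. f (Inl i)) * (\<Prod>j\<in>UNIV. f (Inr j))"
  by (simp flip: UNIV_Plus_UNIV add: prod.Plus)

lemma inner_stack: "stack x y \<bullet> stack x' y' = x \<bullet> x' + y \<bullet> y'"
  by (simp add: inner_vec_def sum_UNIV_Plus)

lemma matrix_vector_mult_stack:
  "A *v stack x y = stack (mat11 A *v x + mat12 A *v y) (mat21 A *v x + mat22 A *v y)"
  by (simp add: matrix_vector_mult_def submat_def stack_def vec_eq_iff sum_UNIV_Plus split: sum.split)

lemma borel_measurable_stack [measurable (raw)]:
  assumes [measurable]: "f \<in> borel_measurable M" "g \<in> borel_measurable M"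
  shows "(\<lambda>z. stack (f z) (g z)) \<in> borel_measurable M"
proof (rule borel_measurable_continuous_Pair[where H = stack])
  have "linear (\<lambda>p::(real^'q) \<times> (real^'p). stack (fst p) (snd p))"
    by (auto intro!: linearI simp: stack_def vec_eq_iff split: sum.split)
  then show "continuous_on UNIV (\<lambda>p::(real^'q) \<times> (real^'p). stack (fst p) (snd p))"
    by (auto intro!: linear_continuous_on simp: linear_conv_bounded_linear)
qed measurable

lemma borel_measurable_subvec [measurable]: "subvec s \<in> borel_measurable borel"
proof -
  have "linear (subvec s)"
    by (auto intro!: linearI simp: subvec_def vec_eq_iff)
  then show ?thesis
    by (auto intro!: borel_measurable_continuous_onI linear_continuous_on simp: linear_conv_bounded_linear)
qed

lemma box_stack:
  "stack x y \<in> box l u \<longleftrightarrow> x \<in> box (vec1 l) (vec1 u) \<and> y \<in> box (vec2 l) (vec2 u)"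
  unfolding mem_box_cart
  by (metis (no_types, opaque_lifting) stack_nth sum.exhaust stack_vec)

lemma emeasure_lborel_box_cart:
  fixes l u :: "real ^ 'n"
  assumes "\<And>i. l $ i \<le> u $ i"
  shows "emeasure lborel (box l u) = (\<Prod>i\<in>UNIV. ennreal (u $ i - l $ i))"
proof -
  have "l \<bullet> b \<le> u \<bullet> b" if "b \<in> Basis" for b
    using that assms by (auto simp: Basis_vec_def inner_axis)
  then show ?thesis
    using assms by (simp add: prod_Basis_cart inner_axis prod_ennreal)
qed

text \<open>A box in the stacked space is a product of two boxes, and \<open>lborel\<close> is
  determined by its values on boxes.\<close>

lemma lborel_stack:
  "(lborel :: (real ^ ('q::finite + 'p::finite)) measure) =
   distr (lborel \<Otimes>\<^sub>M lborel) borel (\<lambda>(x, y). stack x y)"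
proof (rule lborel_eqI)
  fix l u :: "real ^ ('q + 'p)"
  assume le: "\<And>b. b \<in> Basis \<Longrightarrow> l \<bullet> b \<le> u \<bullet> b"
  then have le': "l $ i \<le> u $ i" for i
    by (metis axis_in_Basis_iff cart_eq_inner_axis Basis_real_def singletonI)
  have sub: "vec1 l $ i \<le> vec1 u $ i" "vec2 l $ j \<le> vec2 u $ j" for i j
    using le' by (simp_all add: subvec_def)
  have vimage: "(\<lambda>(x, y). stack x y) -` box l u \<inter> space (lborel \<Otimes>\<^sub>M lborel) =
      box (vec1 l) (vec1 u) \<times> box (vec2 l) (vec2 u)"
    by (auto simp: box_stack space_pair_measure)
  show "emeasure (distr (lborel \<Otimes>\<^sub>M lborel) borel (\<lambda>(x, y). stack x y)) (box l u) =
      ennreal (\<Prod>b\<in>Basis. (u - l) \<bullet> b)"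
    using sub le'
    by (subst emeasure_distr)
       (simp_all add: vimage lborel.emeasure_pair_measure_Times emeasure_lborel_box_cart prod_Basis_cart
          inner_axis prod_UNIV_Plus prod_ennreal prod_nonneg ennreal_mult subvec_def)
qed simp

lemma nn_integral_lborel_stack:
  fixes f :: "real ^ ('q::finite + 'p::finite) \<Rightarrow> ennreal"
  assumes [measurable]: "f \<in> borel_measurable borel"
  shows "(\<integral>\<^sup>+w. f w \<partial>lborel) = (\<integral>\<^sup>+x. (\<integral>\<^sup>+y. f (stack x y) \<partial>lborel) \<partial>lborel)"
    and "(\<integral>\<^sup>+w. f w \<partial>lborel) = (\<integral>\<^sup>+y. (\<integral>\<^sup>+x. f (stack x y) \<partial>lborel) \<partial>lborel)"
proof -
  show "(\<integral>\<^sup>+w. f w \<partial>lborel) = (\<integral>\<^sup>+x. (\<integral>\<^sup>+y. f (stack x y) \<partial>lborel) \<partial>lborel)"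
    by (subst lborel_stack, subst nn_integral_distr)
       (simp_all add: lborel.nn_integral_fst[symmetric] split_beta')
  also have "\<dots> = (\<integral>\<^sup>+y. (\<integral>\<^sup>+x. f (stack x y) \<partial>lborel) \<partial>lborel)"
    by (rule lborel_pair.Fubini') measurable
  finally show "(\<integral>\<^sup>+w. f w \<partial>lborel) = (\<integral>\<^sup>+y. (\<integral>\<^sup>+x. f (stack x y) \<partial>lborel) \<partial>lborel)" .
qed

section \<open>Schur complement: splitting the quadratic form and the determinant\<close>

lemma pos_def_mat11:
  assumes "pos_def_matrix \<Omega>"
  shows "pos_def_matrix (mat11 \<Omega>)"
  unfolding pos_def_matrix_def
proof (intro conjI allI impI)
  show "transpose (mat11 \<Omega>) = mat11 \<Omega>"
    using assms by (simp add: pos_def_matrix_def transpose_def submat_def vec_eq_iff)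
next
  fix x :: "real ^ 'a" assume "x \<noteq> 0"
  then have "stack x (0 :: real ^ 'b) \<noteq> 0"
    by (metis vec_stack(1) stack_vec vec_eq_iff stack_nth(1) zero_index)
  then have "0 < stack x 0 \<bullet> (\<Omega> *v stack x 0)"
    using assms by (auto simp: pos_def_matrix_def)
  then show "0 < x \<bullet> (mat11 \<Omega> *v x)"
    by (simp add: matrix_vector_mult_stack inner_stack)
qed

abbreviation (input) schur :: "real ^ ('q::finite + 'p::finite) ^ ('q::finite + 'p::finite) \<Rightarrow> real ^ 'p ^ 'p" where
  "schur \<Omega> \<equiv> mat22 \<Omega> - mat21 \<Omega> ** matrix_inv (mat11 \<Omega>) ** mat12 \<Omega>"

text \<open>Block elimination, without a formula for the inverse of a block matrix. Writing
  \<open>stack v1 v2\<close> for the inverse applied to \<open>stack x y\<close>, the two block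
  equations give \<open>y - m x = schur \<Omega> *v v2\<close>, and the form is
  \<open>x \<bullet> v1 + y \<bullet> v2\<close>. The vector \<open>m x\<close> is the linear
  regression of the second block on the first.\<close>

lemma quadratic_form_stack:
  assumes \<Omega>: "pos_def_matrix \<Omega>" and S: "pos_def_matrix (schur \<Omega>)"
  defines "m x \<equiv> mat21 \<Omega> *v (matrix_inv (mat11 \<Omega>) *v x)"
  shows "stack x y \<bullet> (matrix_inv \<Omega> *v stack x y) =
    x \<bullet> (matrix_inv (mat11 \<Omega>) *v x) + (y - m x) \<bullet> (matrix_inv (schur \<Omega>) *v (y - m x))"
proof -
  let ?P = "matrix_inv (mat11 \<Omega>)"
  note A = pos_def_mat11[OF \<Omega>]
  define v where "v = matrix_inv \<Omega> *v stack x y"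
  define v1 where "v1 = vec1 v"
  define v2 where "v2 = vec2 v"
  have v: "v = stack v1 v2" by (simp add: v1_def v2_def)
  have "\<Omega> *v stack v1 v2 = stack x y"
    using matrix_inv_vector_cancel(1)[OF pos_def_matrix_invertible[OF \<Omega>]] by (simp add: v[symmetric] v_def)
  then have "vec1 (\<Omega> *v stack v1 v2) = x" "vec2 (\<Omega> *v stack v1 v2) = y"
    by simp_all
  then have x: "x = mat11 \<Omega> *v v1 + mat12 \<Omega> *v v2" and y: "y = mat21 \<Omega> *v v1 + mat22 \<Omega> *v v2"
    by (simp_all add: matrix_vector_mult_stack)
  have Px: "?P *v x = v1 + ?P *v (mat12 \<Omega> *v v2)"
    unfolding x matrix_vector_right_distrib
    using matrix_inv_vector_cancel(2)[OF pos_def_matrix_invertible[OF A]] by simp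
  have "y - m x = schur \<Omega> *v v2"
    unfolding m_def Px by (simp add: y matrix_vector_right_distrib matrix_vector_mult_diff_rdistrib
        matrix_vector_mul_assoc matrix_mul_assoc)
  then have Sv: "matrix_inv (schur \<Omega>) *v (y - m x) = v2"
    using matrix_inv_vector_cancel(2)[OF pos_def_matrix_invertible[OF S]] by simp
  have "transpose (mat12 \<Omega>) = mat21 \<Omega>"
    using \<Omega> by (auto simp: pos_def_matrix_def submat_def transpose_def vec_eq_iff)
  then have "m x \<bullet> v2 = (?P *v x) \<bullet> (mat12 \<Omega> *v v2)"
    unfolding m_def by (metis dot_lmul_matrix vector_transpose_matrix transpose_transpose)
  also have "\<dots> = x \<bullet> (?P *v x) - x \<bullet> v1"
    using pos_def_matrix_symmetric[OF pos_def_matrix_inv[OF A], of x "mat12 \<Omega> *v v2"]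
    by (simp add: Px inner_add_right)
  finally show ?thesis
    unfolding Sv v_def[symmetric] v inner_stack by (simp add: inner_diff_left)
qed

lemma nn_integral_shifted_quadratic_form:
  fixes S :: "real ^ 'p ^ 'p" and F :: "real \<Rightarrow> ennreal"
  assumes S: "pos_def_matrix S" and [measurable]: "F \<in> borel_measurable borel"
  shows "(\<integral>\<^sup>+y. F (a + (y - c) \<bullet> (matrix_inv S *v (y - c))) \<partial>lborel) =
    ennreal (sqrt (det S)) * (\<integral>\<^sup>+z. F (a + z \<bullet> z) \<partial>(lborel :: (real ^ 'p) measure))"
proof -
  have "(\<integral>\<^sup>+y. F (a + (y - c) \<bullet> (matrix_inv S *v (y - c))) \<partial>lborel) =
     (\<integral>\<^sup>+y. F (a + (- c + y) \<bullet> (matrix_inv S *v (- c + y))) \<partial>lborel)"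
    by simp
  also have "\<dots> = (\<integral>\<^sup>+y. F (a + y \<bullet> (matrix_inv S *v y)) \<partial>lborel)"
    by (rule nn_integral_lborel_translate) measurable
  also have "\<dots> = ennreal (sqrt (det S)) * (\<integral>\<^sup>+z. F (a + z \<bullet> z) \<partial>(lborel :: (real ^ 'p) measure))"
    by (rule nn_integral_quadratic_form[OF S]) measurable
  finally show ?thesis .
qed

text \<open>The volume of the ellipsoid on which the form is less than \<open>1\<close> is computed
  twice, once directly and once by slicing along the first block. Both results are multiples of the
  volume of the unit ball, which cancels.\<close>

lemma sqrt_det_schur:
  assumes \<Omega>: "pos_def_matrix \<Omega>" and S: "pos_def_matrix (schur \<Omega>)"
  shows "sqrt (det \<Omega>) = sqrt (det (mat11 \<Omega>)) * sqrt (det (schur \<Omega>))"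
proof -
  define F :: "real \<Rightarrow> ennreal" where "F = indicator {..<1}"
  have [measurable]: "F \<in> borel_measurable borel" by (simp add: F_def)
  let ?V = "\<integral>\<^sup>+w. F (w \<bullet> w) \<partial>(lborel :: (real ^ ('a + 'b)) measure)"
  let ?c = "\<lambda>x. mat21 \<Omega> *v (matrix_inv (mat11 \<Omega>) *v x)"
  note A = pos_def_mat11[OF \<Omega>]
  have V: "?V = emeasure lborel (ball (0 :: real ^ ('a + 'b)) 1)"
    by (simp add: F_def indicator_def dot_square_norm abs_square_less_1 flip: nn_integral_indicator)
  have "ennreal (sqrt (det \<Omega>)) * ?V = (\<integral>\<^sup>+w. F (w \<bullet> (matrix_inv \<Omega> *v w)) \<partial>lborel)"
    by (rule nn_integral_quadratic_form[OF \<Omega>, symmetric]) measurable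
  also have "\<dots> = (\<integral>\<^sup>+x. (\<integral>\<^sup>+y. F (x \<bullet> (matrix_inv (mat11 \<Omega>) *v x) +
      (y - ?c x) \<bullet> (matrix_inv (schur \<Omega>) *v (y - ?c x))) \<partial>lborel) \<partial>lborel)"
    by (subst nn_integral_lborel_stack(1)) (simp_all add: quadratic_form_stack[OF \<Omega> S])
  also have "\<dots> = (\<integral>\<^sup>+x. ennreal (sqrt (det (schur \<Omega>))) *
      (\<integral>\<^sup>+z. F (x \<bullet> (matrix_inv (mat11 \<Omega>) *v x) + z \<bullet> z) \<partial>(lborel :: (real ^ 'b) measure)) \<partial>lborel)"
    by (simp only: nn_integral_shifted_quadratic_form[OF S \<open>F \<in> borel_measurable borel\<close>])
  also have "\<dots> = ennreal (sqrt (det (schur \<Omega>))) * (\<integral>\<^sup>+x.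
      (\<integral>\<^sup>+z. F (x \<bullet> (matrix_inv (mat11 \<Omega>) *v x) + z \<bullet> z) \<partial>(lborel :: (real ^ 'b) measure)) \<partial>lborel)"
    by (rule nn_integral_cmult) measurable
  also have "\<dots> = ennreal (sqrt (det (schur \<Omega>))) * (ennreal (sqrt (det (mat11 \<Omega>))) *
      (\<integral>\<^sup>+x. (\<integral>\<^sup>+z. F (x \<bullet> x + z \<bullet> z) \<partial>(lborel :: (real ^ 'b) measure)) \<partial>(lborel :: (real ^ 'a) measure)))"
    by (subst nn_integral_quadratic_form[OF A]) simp_all
  also have "(\<integral>\<^sup>+x. (\<integral>\<^sup>+z. F (x \<bullet> x + z \<bullet> z) \<partial>(lborel :: (real ^ 'b) measure)) \<partial>(lborel :: (real ^ 'a) measure)) = ?V"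
    by (subst nn_integral_lborel_stack(1)) (simp_all add: inner_stack)
  finally have "?V * ennreal (sqrt (det \<Omega>)) = ?V * ennreal (sqrt (det (schur \<Omega>)) * sqrt (det (mat11 \<Omega>)))"
    using det_pos_def_matrix[OF S] det_pos_def_matrix[OF A]
    by (simp add: ennreal_mult mult_ac)
  then have "ennreal (sqrt (det \<Omega>)) = ennreal (sqrt (det (schur \<Omega>)) * sqrt (det (mat11 \<Omega>)))"
    unfolding V using emeasure_unit_ball_pos_finite[where 'a = "real ^ ('a + 'b)"]
    by (simp only: ennreal_mult_cancel_left) auto
  then show ?thesis
    using det_pos_def_matrix[OF S] det_pos_def_matrix[OF A] det_pos_def_matrix[OF \<Omega>]
    by (simp add: mult.commute)
qed

subsection \<open>Null sets and quadratic forms\<close>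

lemma nn_integral_lborel_scaleR:
  fixes f :: "'a::euclidean_space \<Rightarrow> ennreal"
  assumes [measurable]: "f \<in> borel_measurable borel" and "0 < s"
  shows "(\<integral>\<^sup>+x. f x \<partial>lborel) = ennreal (s ^ DIM('a)) * (\<integral>\<^sup>+x. f (s *\<^sub>R x) \<partial>lborel)"
  using \<open>0 < s\<close>
  by (subst lborel_affine[of s 0]) (simp_all add: nn_integral_density nn_integral_distr nn_integral_cmult)

text \<open>Integrating in polar fashion without polar coordinates: by scaling, every dilate of \<open>K\<close> is null
  as soon as one is, and Fubini exchanges the dilation factor with the point.\<close>

lemma null_iff_AE_rays:
  fixes K :: "'a::euclidean_space set"
  assumes [measurable]: "K \<in> sets borel"
  shows "emeasure lborel K = 0 \<longleftrightarrow> (AE v in lborel. AE s in lborel. 0 < s \<longrightarrow> s *\<^sub>R v \<notin> K)"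
proof -
  have "(AE v in lborel. AE s in lborel. 0 < s \<longrightarrow> s *\<^sub>R v \<notin> K) \<longleftrightarrow>
      (AE v in lborel. (\<integral>\<^sup>+s. indicator {0<..} s * indicator K (s *\<^sub>R v) \<partial>lborel) = 0)"
    by (subst nn_integral_0_iff_AE) (auto simp: indicator_def)
  also have "\<dots> \<longleftrightarrow> (\<integral>\<^sup>+v. (\<integral>\<^sup>+s. indicator {0<..} s * indicator K (s *\<^sub>R v) \<partial>lborel) \<partial>lborel) = 0"
    by (subst nn_integral_0_iff_AE) auto
  also have "(\<integral>\<^sup>+v. (\<integral>\<^sup>+s. indicator {0<..} s * indicator K (s *\<^sub>R v) \<partial>lborel) \<partial>lborel) =
      (\<integral>\<^sup>+s. (\<integral>\<^sup>+v. indicator {0<..} s * indicator K (s *\<^sub>R v) \<partial>lborel) \<partial>lborel)"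
    by (rule lborel_pair.Fubini') measurable
  also have "\<dots> = 0 \<longleftrightarrow> (AE s in lborel. (\<integral>\<^sup>+v. indicator {0<..} s * indicator K (s *\<^sub>R v) \<partial>lborel) = 0)"
    by (subst nn_integral_0_iff_AE) auto
  also have "\<dots> \<longleftrightarrow> (AE s in lborel. 0 < (s::real) \<longrightarrow> emeasure lborel K = 0)"
  proof (intro AE_cong)
    fix s :: real
    have "emeasure lborel K = ennreal (s ^ DIM('a)) * (\<integral>\<^sup>+v. indicator K (s *\<^sub>R v) \<partial>lborel)" if "0 < s"
      using nn_integral_lborel_scaleR[of "indicator K" s] that by simp
    then show "(\<integral>\<^sup>+v. indicator {0<..} s * indicator K (s *\<^sub>R v) \<partial>lborel) = 0 \<longleftrightarrow>
        (0 < s \<longrightarrow> emeasure lborel K = 0)"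
      by (cases "0 < s") (auto simp: nn_integral_cmult)
  qed
  also have "\<dots> \<longleftrightarrow> emeasure lborel K = 0"
  proof
    assume AE: "AE s in lborel. 0 < (s::real) \<longrightarrow> emeasure lborel K = 0"
    show "emeasure lborel K = 0"
    proof (rule ccontr)
      assume "emeasure lborel K \<noteq> 0"
      with AE have "AE s in lborel. s \<notin> {0::real<..<1}" by auto
      then have "{0::real<..<1} \<in> null_sets lborel"
        by (subst AE_iff_null_sets) auto
      then show False by (auto dest: null_setsD1)
    qed
  qed simp
  finally show ?thesis by simp
qed

text \<open>Differentiable images of negligible sets are negligible. The image of a Borel set need
  not be Borel, so the conclusion concerns a Borel subset \<open>T\<close> of it.\<close>

lemma null_sets_image_real:
  fixes \<phi> :: "real \<Rightarrow> real"
  assumes "emeasure lborel S = 0" "S \<in> sets borel" "\<phi> differentiable_on S"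
    and "T \<in> sets borel" "T \<subseteq> \<phi> ` S"
  shows "emeasure lborel T = 0"
proof -
  have "S \<in> null_sets lborel"
    using assms by (simp add: null_sets_def)
  then have "negligible S"
    by (simp add: negligible_iff_null_sets null_sets_completionI)
  then have "negligible (\<phi> ` S)"
    using assms by (intro negligible_differentiable_image_negligible) auto
  then have "negligible T"
    using assms negligible_subset by blast
  then have "T \<in> null_sets lborel"
    using assms by (simp add: negligible_iff_null_sets null_sets_completion_iff)
  then show ?thesis by (rule null_setsD1)
qed

text \<open>Rational right end points \<open>r\<close> reduce the claim to countably many sets
  \<open>G\<close>. A point of \<open>G\<close> makes the part of \<open>H\<close> between it and
  \<open>r\<close> null, so countably many points chosen from \<open>G\<close> cover by null sets
  whatever of \<open>G\<close> lies to the right of one of them.\<close>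

lemma AE_not_right_isolated:
  assumes [measurable]: "H \<in> sets borel"
  shows "AE u in lborel. u \<in> H \<longrightarrow> (\<forall>e>0. emeasure lborel (H \<inter> {u<..<u + e::real}) \<noteq> 0)"
proof -
  have "\<exists>Z\<in>null_sets lborel. {u\<in>H. u < r \<and> emeasure lborel (H \<inter> {u<..<r}) = 0} \<subseteq> Z" for r :: real
  proof -
    define G where "G = {u\<in>H. u < r \<and> emeasure lborel (H \<inter> {u<..<r}) = 0}"
    define d where "d s = (SOME u. u \<in> G \<and> u < s)" for s
    define R where "R = {s\<in>\<rat>. \<exists>u\<in>G. u < s}"
    have d: "d s \<in> G" "d s < s" if "s \<in> R" for s
      using someI_ex[of "\<lambda>u. u \<in> G \<and> u < s"] that by (auto simp: R_def d_def)
    \<comment> \<open>Only a least element of \<open>G\<close> can escape the intervals: below any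
      other \<open>w\<close> there are a point of \<open>G\<close> and then a rational
      \<open>s\<close> in between, so that \<open>d s < s < w\<close>.\<close>
    define Z where "Z = {u\<in>G. \<forall>w\<in>G. u \<le> w} \<union> (\<Union>s\<in>R. H \<inter> {d s<..<r})"
    let ?L = "{u\<in>G. \<forall>w\<in>G. u \<le> w}"
    have "finite ?L"
    proof (cases "?L = {}")
      case False
      then obtain u where "u \<in> ?L" by blast
      then have "?L \<subseteq> {u}" by (auto intro: antisym)
      then show ?thesis by (rule finite_subset) simp
    next
      case True
      then show ?thesis by (simp only: finite.emptyI)
    qed
    then have "?L \<in> null_sets lborel"
      by (rule finite_imp_null_set_lborel)
    moreover have "countable R"
      unfolding R_def using countable_rat by (rule countable_subset[rotated]) auto
    then have "(\<Union>s\<in>R. H \<inter> {d s<..<r}) \<in> null_sets lborel"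
      using d by (intro null_sets_UN') (auto simp: null_sets_def G_def)
    ultimately have "Z \<in> null_sets lborel"
      unfolding Z_def by auto
    moreover have "G \<subseteq> Z"
    proof
      fix w assume w: "w \<in> G"
      show "w \<in> Z"
      proof (cases "\<forall>u\<in>G. w \<le> u")
        case True
        with w show ?thesis by (auto simp: Z_def)
      next
        case False
        then obtain u where u: "u \<in> G" "u < w" by auto
        obtain s where s: "s \<in> \<rat>" "u < s" "s < w"
          using Rats_dense_in_real[OF u(2)] by auto
        then have "s \<in> R" using u by (auto simp: R_def)
        then show ?thesis
          using d[of s] s w by (auto simp: Z_def G_def intro!: bexI[of _ s])
      qed
    qed
    ultimately show ?thesis unfolding G_def by blast
  qed
  then obtain Z where Z: "\<And>r. Z r \<in> null_sets lborel"
    "\<And>r. {u\<in>H. u < r \<and> emeasure lborel (H \<inter> {u<..<r}) = 0} \<subseteq> Z r"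
    by metis
  have "(\<Union>r\<in>\<rat>. Z r) \<in> null_sets lborel"
    using Z(1) countable_rat by (intro null_sets_UN') auto
  then show ?thesis
  proof (rule AE_I', intro subsetI)
    fix u :: real
    assume "u \<in> {u \<in> space lborel. \<not> (u \<in> H \<longrightarrow> (\<forall>e>0. emeasure lborel (H \<inter> {u<..<u + e}) \<noteq> 0))}"
    then obtain e where u: "u \<in> H" "0 < e" "emeasure lborel (H \<inter> {u<..<u + e}) = 0"
      by auto
    obtain r where r: "r \<in> \<rat>" "u < r" "r < u + e"
      using Rats_dense_in_real[of u "u + e"] u by auto
    have "emeasure lborel (H \<inter> {u<..<r}) \<le> emeasure lborel (H \<inter> {u<..<u + e})"
      using r by (intro emeasure_mono) auto
    then have "u \<in> Z r"
      using u r Z(2)[of r] by auto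
    then show "u \<in> (\<Union>r\<in>\<rat>. Z r)" using r by auto
  qed
qed

lemma AE_not_left_isolated:
  assumes [measurable]: "H \<in> sets borel"
  shows "AE u in lborel. u \<in> H \<longrightarrow> (\<forall>e>0. emeasure lborel (H \<inter> {u - e<..<u::real}) \<noteq> 0)"
proof -
  let ?H = "uminus -` H"
  have [measurable]: "?H \<in> sets borel"
    by (rule measurable_sets_borel[OF _ assms]) simp
  have "AE u in distr lborel borel uminus. u \<in> ?H \<longrightarrow> (\<forall>e>0. emeasure lborel (?H \<inter> {u<..<u + e}) \<noteq> 0)"
    unfolding lborel_distr_uminus by (rule AE_not_right_isolated) measurable
  then have "AE u in lborel. - u \<in> ?H \<longrightarrow> (\<forall>e>0. emeasure lborel (?H \<inter> {- u<..<- u + e}) \<noteq> 0)"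
    by (rule AE_distrD[rotated]) simp
  moreover have "emeasure lborel (?H \<inter> {- u<..<- u + e}) = emeasure lborel (H \<inter> {u - e<..<u})" for u e :: real
  proof -
    have "emeasure lborel (H \<inter> {u - e<..<u}) = emeasure (distr lborel borel uminus) (H \<inter> {u - e<..<u})"
      by (simp add: lborel_distr_uminus)
    also have "\<dots> = emeasure lborel (uminus -` (H \<inter> {u - e<..<u}))"
      by (subst emeasure_distr) auto
    also have "uminus -` (H \<inter> {u - e<..<u}) = ?H \<inter> {- u<..<- u + e}"
      by auto
    finally show ?thesis by simp
  qed
  ultimately show ?thesis by simp
qed

text \<open>On a ray the form is \<open>a + s\<^sup>2 * q\<close> with \<open>q > 0\<close>, whose
  inverse is differentiable above \<open>a\<close>; null sets of values therefore pull back to null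
  sets of \<open>s\<close>. \<open>null_iff_AE_rays\<close> carries this from rays to the whole
  space.\<close>

lemma AE_quadratic_form:
  fixes Q :: "real ^ 'p ^ 'p"
  assumes Q: "pos_def_matrix Q" and P: "AE u in lborel. P u"
  shows "AE y in lborel. P (a + (y - c) \<bullet> (Q *v (y - c)))"
proof -
  obtain N where N: "{u. \<not> P u} \<subseteq> N" "N \<in> null_sets lborel"
    using AE_E[OF P] by (auto simp: null_sets_def)
  have [measurable]: "N \<in> sets borel" and N0: "emeasure lborel N = 0" using N by auto
  define K where "K = {z. a + z \<bullet> (Q *v z) \<in> N}"
  have [measurable]: "K \<in> sets borel" unfolding K_def by measurable
  have "AE v in lborel. AE s in lborel. 0 < s \<longrightarrow> s *\<^sub>R v \<notin> K"
    using AE_lborel_singleton[of "0 :: real ^ 'p"]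
  proof eventually_elim
    case (elim v)
    let ?q = "v \<bullet> (Q *v v)"
    have q: "0 < ?q" using Q elim by (auto simp: pos_def_matrix_def)
    \<comment> \<open>The value \<open>a\<close> is left out because the square root is not
      differentiable there; it would correspond to \<open>s = 0\<close> only.\<close>
    have "emeasure lborel {s. 0 < s \<and> a + s\<^sup>2 * ?q \<in> N} = 0"
    proof (rule null_sets_image_real[where S = "N \<inter> {a<..}" and \<phi> = "\<lambda>u. sqrt ((u - a) / ?q)"])
      have "emeasure lborel (N \<inter> {a<..}) \<le> emeasure lborel N"
        by (intro emeasure_mono) auto
      with N0 show "emeasure lborel (N \<inter> {a<..}) = 0" by simp
      show "(\<lambda>u. sqrt ((u - a) / ?q)) differentiable_on N \<inter> {a<..}"
        unfolding differentiable_on_def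
      proof
        fix u assume "u \<in> N \<inter> {a<..}"
        then have "0 < (u - a) / ?q" using q by simp
        then have "((\<lambda>u. sqrt ((u - a) / ?q)) has_real_derivative
            inverse (sqrt ((u - a) / ?q)) / 2 * (1 / ?q)) (at u)"
          using q by (auto intro!: derivative_eq_intros)
        then show "(\<lambda>u. sqrt ((u - a) / ?q)) differentiable at u within N \<inter> {a<..}"
          using differentiable_at_withinI real_differentiable_def by blast
      qed
      show "{s. 0 < s \<and> a + s\<^sup>2 * ?q \<in> N} \<subseteq> (\<lambda>u. sqrt ((u - a) / ?q)) ` (N \<inter> {a<..})"
      proof safe
        fix s :: real assume s: "0 < s" "a + s\<^sup>2 * ?q \<in> N"
        show "s \<in> (\<lambda>u. sqrt ((u - a) / ?q)) ` (N \<inter> {a<..})"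
          using s q by (intro image_eqI[of _ _ "a + s\<^sup>2 * ?q"]) auto
      qed
    qed measurable
    then have "AE s in lborel. s \<notin> {s. 0 < s \<and> a + s\<^sup>2 * ?q \<in> N}"
      by (intro AE_not_in) (simp add: null_sets_def)
    then show ?case
      by (simp add: K_def matrix_vector_mult_scaleR power2_eq_square mult.assoc)
  qed
  then have "emeasure lborel K = 0"
    by (simp add: null_iff_AE_rays)
  then have "AE y in distr lborel borel ((+) (- c)). y \<notin> K"
    unfolding lborel_distr_plus by (intro AE_not_in) (simp add: null_sets_def)
  then have "AE y in lborel. - c + y \<notin> K"
    by (rule AE_distrD[rotated]) simp
  then show ?thesis
    by eventually_elim (use N in \<open>auto simp: K_def\<close>)
qed

text \<open>Along almost every ray in \<open>C\<close> the polynomial avoids \<open>H\<close> almost everywhere, and it sweeps out a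
  one-sided neighbourhood of its value at the origin.\<close>

lemma quadratic_avoids_imp_one_sided_null:
  fixes P :: "real ^ 'q ^ 'q" and C :: "(real ^ 'q) set"
  assumes P: "pos_def_matrix P"
    and [measurable]: "H \<in> sets borel" "C \<in> sets borel"
    and cone: "\<And>s v. 0 < s \<Longrightarrow> v \<in> C \<Longrightarrow> s *\<^sub>R v \<in> C" and C: "emeasure lborel C \<noteq> 0"
    and null: "emeasure lborel {x\<in>C. u + b \<bullet> x + x \<bullet> (P *v x) \<in> H} = 0"
  shows "\<exists>e>0. emeasure lborel (H \<inter> {u<..<u + e}) = 0 \<or> emeasure lborel (H \<inter> {u - e<..<u}) = 0"
proof -
  let ?K = "{x\<in>C. u + b \<bullet> x + x \<bullet> (P *v x) \<in> H}"
  have "AE v in lborel. AE s in lborel. 0 < s \<longrightarrow> s *\<^sub>R v \<notin> ?K"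
    using null by (subst null_iff_AE_rays[symmetric]) auto
  then have rays: "AE v in lborel. v \<noteq> 0 \<and> (AE s in lborel. 0 < s \<longrightarrow> s *\<^sub>R v \<notin> ?K)"
    using AE_lborel_singleton[of "0 :: real ^ 'q"] by eventually_elim auto
  \<comment> \<open>Almost every direction is good and \<open>C\<close> is not null, so
    \<open>C\<close> contains a good direction.\<close>
  obtain v where v: "v \<in> C" "v \<noteq> 0" "AE s in lborel. 0 < s \<longrightarrow> s *\<^sub>R v \<notin> ?K"
  proof (rule ccontr)
    assume "\<not> thesis"
    then have "\<And>v. v \<noteq> 0 \<and> (AE s in lborel. 0 < s \<longrightarrow> s *\<^sub>R v \<notin> ?K) \<Longrightarrow> v \<notin> C"
      using that by blast
    with rays have "AE v in lborel. v \<notin> C" by (rule eventually_mono)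
    then have "C \<in> null_sets lborel"
      by (subst AE_iff_null_sets) auto
    with C show False by (auto dest: null_setsD1)
  qed
  define \<phi> where "\<phi> s = u + s * (b \<bullet> v) + s\<^sup>2 * (v \<bullet> (P *v v))" for s :: real
  define S where "S = {s. 0 < s \<and> \<phi> s \<in> H}"
  have pos: "0 < v \<bullet> (P *v v)" using P v by (auto simp: pos_def_matrix_def)
  have cont: "continuous_on A \<phi>" for A
    unfolding \<phi>_def by (intro continuous_intros)
  have [measurable]: "\<phi> \<in> borel_measurable borel"
    by (intro borel_measurable_continuous_onI cont)
  have [measurable]: "S \<in> sets borel" unfolding S_def by measurable
  have "AE s in lborel. s \<notin> S"
    using v(3)
  proof eventually_elim
    case (elim s)
    then show ?case
      using cone[of s v] v(1)
      by (auto simp: S_def \<phi>_def matrix_vector_mult_scaleR power2_eq_square mult.assoc)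
  qed
  then have "S \<in> null_sets lborel"
    using AE_iff_null_sets[of S lborel] by simp
  then have S0: "emeasure lborel S = 0" by (rule null_setsD1)
  have diff: "\<phi> differentiable_on S"
    unfolding \<phi>_def differentiable_on_def
    by (intro ballI derivative_intros)
  have \<phi>0: "\<phi> 0 = u" by (simp add: \<phi>_def)
  \<comment> \<open>With \<open>q\<close> the value of the form at \<open>v\<close>, both equalities
    together would give \<open>b \<bullet> v = - q\<close> and
    \<open>b \<bullet> v = - 2 * q\<close>, hence \<open>q = 0\<close>.\<close>
  have "\<phi> 1 \<noteq> u \<or> \<phi> 2 \<noteq> u"
    using pos by (auto simp: \<phi>_def)
  then obtain t where t: "0 < t" "\<phi> t \<noteq> u"
    by (metis zero_less_numeral zero_less_one)
  show ?thesis
  \<comment> \<open>The linear coefficient has no known sign, so the position of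
    \<open>\<phi> t\<close> decides on which side of \<open>u\<close> the intermediate value theorem
    supplies an interval.\<close>
  proof (cases "u < \<phi> t")
    case True
    have "H \<inter> {u<..<\<phi> t} \<subseteq> \<phi> ` S"
    proof
      fix w assume w: "w \<in> H \<inter> {u<..<\<phi> t}"
      then obtain s where "0 \<le> s" "s \<le> t" "\<phi> s = w"
        using IVT'[of \<phi> 0 w t] t cont \<phi>0 by auto
      with w \<phi>0 show "w \<in> \<phi> ` S"
        by (intro image_eqI[of _ _ s]) (auto simp: S_def less_le)
    qed
    then have "emeasure lborel (H \<inter> {u<..<\<phi> t}) = 0"
      by (intro null_sets_image_real[OF S0 _ diff]) auto
    then show ?thesis
      using True by (intro exI[of _ "\<phi> t - u"]) auto
  next
    case False
    have "H \<inter> {\<phi> t<..<u} \<subseteq> \<phi> ` S"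
    proof
      fix w assume w: "w \<in> H \<inter> {\<phi> t<..<u}"
      then obtain s where "0 \<le> s" "s \<le> t" "\<phi> s = w"
        using IVT2'[of \<phi> t w 0] t cont \<phi>0 by auto
      with w \<phi>0 show "w \<in> \<phi> ` S"
        by (intro image_eqI[of _ _ s]) (auto simp: S_def less_le)
    qed
    then have "emeasure lborel (H \<inter> {\<phi> t<..<u}) = 0"
      by (intro null_sets_image_real[OF S0 _ diff]) auto
    then show ?thesis
      using False t by (intro exI[of _ "u - \<phi> t"]) auto
  qed
qed

text \<open>The generator may vanish on arbitrary Borel sets, so that positivity of the density at
  \<open>(0, y)\<close> says nothing about its values nearby for an individual \<open>y\<close>; it does for almost every \<open>y\<close>.\<close>

lemma AE_section_not_null:
  fixes \<Omega> :: "real ^ ('q::finite + 'p::finite) ^ ('q + 'p)" and \<xi> :: "real ^ ('q + 'p)" and C :: "(real ^ 'q) set"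
  assumes \<Omega>: "pos_def_matrix \<Omega>" and S: "pos_def_matrix (schur \<Omega>)"
    and [measurable]: "H \<in> sets borel" "C \<in> sets borel"
    and cone: "\<And>s v. 0 < s \<Longrightarrow> v \<in> C \<Longrightarrow> s *\<^sub>R v \<in> C" and C: "emeasure lborel C \<noteq> 0"
  defines "Q x y \<equiv> (stack x y - \<xi>) \<bullet> (matrix_inv \<Omega> *v (stack x y - \<xi>))"
  shows "AE y in lborel. Q 0 y \<in> H \<longrightarrow> emeasure lborel {x\<in>C. Q x y \<in> H} \<noteq> 0"
proof -
  let ?P = "matrix_inv \<Omega>"
  note P = pos_def_matrix_inv[OF \<Omega>]
  let ?c = "vec2 \<xi> + mat21 \<Omega> *v (matrix_inv (mat11 \<Omega>) *v (- vec1 \<xi>))"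
  let ?a = "(- vec1 \<xi>) \<bullet> (matrix_inv (mat11 \<Omega>) *v (- vec1 \<xi>))"
  \<comment> \<open>Completing the square at \<open>x = 0\<close> brings the form into the shape
    required by \<open>AE_quadratic_form\<close>, which transfers the statement about real values
    \<open>u\<close> to points \<open>y\<close>.\<close>
  have Q0: "Q 0 y = ?a + (y - ?c) \<bullet> (matrix_inv (schur \<Omega>) *v (y - ?c))" for y
    unfolding Q_def stack_diff quadratic_form_stack[OF \<Omega> S] by (simp add: diff_diff_eq)
  have "AE u in lborel. u \<in> H \<longrightarrow> (\<forall>e>0. emeasure lborel (H \<inter> {u<..<u + e}) \<noteq> 0 \<and>
      emeasure lborel (H \<inter> {u - e<..<u}) \<noteq> 0)"
    using AE_not_right_isolated[of H] AE_not_left_isolated[of H] by auto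
  then have "AE y in lborel. Q 0 y \<in> H \<longrightarrow> (\<forall>e>0. emeasure lborel (H \<inter> {Q 0 y<..<Q 0 y + e}) \<noteq> 0 \<and>
      emeasure lborel (H \<inter> {Q 0 y - e<..<Q 0 y}) \<noteq> 0)"
    unfolding Q0 by (rule AE_quadratic_form[OF pos_def_matrix_inv[OF S]])
  then show ?thesis
  proof eventually_elim
    case (elim y)
    show ?case
    proof (intro impI notI)
      assume "Q 0 y \<in> H" and null: "emeasure lborel {x\<in>C. Q x y \<in> H} = 0"
      let ?w = "stack 0 y - \<xi>"
      \<comment> \<open>As a polynomial in \<open>x\<close> with \<open>y\<close> fixed, the form
        has as leading part the upper left block of \<open>matrix_inv \<Omega>\<close>, as opposed
        to the inverse of the upper left block of \<open>\<Omega>\<close>.\<close>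
      have Q: "Q x y = Q 0 y + (2 *\<^sub>R vec1 (?P *v ?w)) \<bullet> x + x \<bullet> (mat11 ?P *v x)" for x
      proof -
        have eq: "stack x y - \<xi> = ?w + stack x 0"
          by (simp add: stack_def vec_eq_iff split: sum.split)
        have "Q x y = Q 0 y + 2 * (stack x 0 \<bullet> (?P *v ?w)) + stack x 0 \<bullet> (?P *v stack x 0)"
          unfolding Q_def eq matrix_vector_right_distrib inner_add_left inner_add_right
          using pos_def_matrix_symmetric[OF P, of ?w "stack x 0"] by (simp add: inner_commute)
        also have "stack x 0 \<bullet> (?P *v ?w) = x \<bullet> vec1 (?P *v ?w)"
          using inner_stack[of x 0 "vec1 (?P *v ?w)" "vec2 (?P *v ?w)"] by simp
        also have "stack x 0 \<bullet> (?P *v stack x 0) = x \<bullet> (mat11 ?P *v x)"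
          by (simp add: matrix_vector_mult_stack inner_stack)
        finally show ?thesis by (simp add: inner_commute)
      qed
      have "{x\<in>C. Q x y \<in> H} =
          {x\<in>C. Q 0 y + (2 *\<^sub>R vec1 (?P *v ?w)) \<bullet> x + x \<bullet> (mat11 ?P *v x) \<in> H}"
        by (intro Collect_cong conj_cong refl, subst Q, rule refl)
      with null have "emeasure lborel
          {x\<in>C. Q 0 y + (2 *\<^sub>R vec1 (?P *v ?w)) \<bullet> x + x \<bullet> (mat11 ?P *v x) \<in> H} = 0"
        by simp
      with pos_def_mat11[OF P] assms(3,4) cone C
      have "\<exists>e>0. emeasure lborel (H \<inter> {Q 0 y<..<Q 0 y + e}) = 0 \<or>
          emeasure lborel (H \<inter> {Q 0 y - e<..<Q 0 y}) = 0"
        by (rule quadratic_avoids_imp_one_sided_null)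
      with elim \<open>Q 0 y \<in> H\<close> show False by auto
    qed
  qed
qed

subsection \<open>Elliptical laws\<close>

lemma pos_def_matrix_nonneg: "pos_def_matrix A \<Longrightarrow> 0 \<le> x \<bullet> (A *v x)"
  by (cases "x = 0") (auto simp: pos_def_matrix_def less_imp_le)

lemma EC_density_nonneg:
  assumes "pos_def_matrix \<Omega>" "\<forall>u\<ge>0. 0 \<le> h u"
  shows "0 \<le> EC_density \<xi> \<Omega> h x"
  using assms pos_def_matrix_nonneg[OF pos_def_matrix_inv[OF assms(1)]] det_pos_def_matrix[OF assms(1)]
  by (auto simp: EC_density_def intro!: divide_nonneg_nonneg)

text \<open>A generator is only constrained on \<open>[0, \<infinity>)\<close>, hence the composition with \<open>max 0\<close>.\<close>

lemma borel_measurable_generator: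
  fixes \<Omega> :: "real ^ 'n ^ 'n"
  assumes \<Omega>: "pos_def_matrix \<Omega>" and h: "\<forall>u\<ge>0. 0 \<le> h u"
    and meas: "(\<lambda>x. ennreal (EC_density \<xi> \<Omega> h x)) \<in> borel_measurable borel"
  shows "(\<lambda>u. h (max 0 u)) \<in> borel_measurable borel"
proof -
  note P = pos_def_matrix_inv[OF \<Omega>]
  define v :: "real ^ 'n" where "v = axis undefined 1"
  let ?q = "v \<bullet> (matrix_inv \<Omega> *v v)"
  have "v \<noteq> 0" by (simp add: v_def axis_eq_0_iff)
  then have q: "0 < ?q" using P by (auto simp: pos_def_matrix_def)
  \<comment> \<open>On the ray from \<open>\<xi>\<close> along \<open>v\<close>, this is the point
    where the form takes the value \<open>max 0 u\<close>; composing the density with this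
    measurable curve recovers \<open>h\<close>.\<close>
  define x where "x u = \<xi> + sqrt (max 0 u / ?q) *\<^sub>R v" for u
  have [measurable]: "x \<in> borel_measurable borel"
    unfolding x_def by measurable
  have "EC_density \<xi> \<Omega> h (x u) = h (max 0 u) / sqrt (det \<Omega>)" for u
  proof -
    have "(x u - \<xi>) \<bullet> (matrix_inv \<Omega> *v (x u - \<xi>)) = (sqrt (max 0 u / ?q))\<^sup>2 * ?q"
      unfolding power2_eq_square by (simp add: x_def matrix_vector_mult_scaleR mult.assoc del: real_sqrt_mult_self)
    also have "\<dots> = max 0 u" using q by simp
    finally show ?thesis by (simp add: EC_density_def)
  qed
  moreover have "0 < sqrt (det \<Omega>)"
    using det_pos_def_matrix[OF \<Omega>] by simp
  ultimately have "(\<lambda>u. h (max 0 u)) =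
      (\<lambda>u. sqrt (det \<Omega>) * enn2real (ennreal (EC_density \<xi> \<Omega> h (x u))))"
    using h by (auto simp: fun_eq_iff)
  also have "\<dots> \<in> borel_measurable borel"
    using measurable_compose[OF _ meas, of x borel] by measurable
  finally show ?thesis .
qed

text \<open>The point \<open>c x\<close> is the conditional location of the second block given the
  first; at \<open>x = 0\<close> it is the location of the law of \<open>W0\<close>.\<close>

lemma EC_density_stack:
  fixes \<xi> :: "real ^ ('q::finite + 'p::finite)"
  assumes \<Omega>: "pos_def_matrix \<Omega>" and S: "pos_def_matrix (schur \<Omega>)"
  defines "c x \<equiv> vec2 \<xi> + mat21 \<Omega> *v (matrix_inv (mat11 \<Omega>) *v (x - vec1 \<xi>))"
  shows "EC_density \<xi> \<Omega> h (stack x y) =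
    h ((x - vec1 \<xi>) \<bullet> (matrix_inv (mat11 \<Omega>) *v (x - vec1 \<xi>)) +
       (y - c x) \<bullet> (matrix_inv (schur \<Omega>) *v (y - c x))) /
    (sqrt (det (mat11 \<Omega>)) * sqrt (det (schur \<Omega>)))"
  unfolding EC_density_def stack_diff quadratic_form_stack[OF \<Omega> S] sqrt_det_schur[OF \<Omega> S]
  by (simp add: c_def diff_diff_eq)

text \<open>Integrating out \<open>y\<close> produces the square root of the determinant of the
  Schur complement, which cancels against the one in the joint density. The statement lives in
  \<open>ennreal\<close> because the integral may be infinite for some \<open>x\<close>.\<close>

lemma nn_integral_EC_density_section:
  fixes \<xi> :: "real ^ ('q::finite + 'p::finite)" and \<Omega> :: "real ^ ('q + 'p) ^ ('q + 'p)"
  assumes \<Omega>: "pos_def_matrix \<Omega>" and S: "pos_def_matrix (schur \<Omega>)"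
    and h: "\<forall>u\<ge>0. 0 \<le> h u" and meas: "(\<lambda>u. h (max 0 u)) \<in> borel_measurable borel"
  defines "\<delta> x \<equiv> (x - vec1 \<xi>) \<bullet> (matrix_inv (mat11 \<Omega>) *v (x - vec1 \<xi>))"
  shows "(\<integral>\<^sup>+y. ennreal (EC_density \<xi> \<Omega> h (stack x y)) \<partial>lborel) =
    (\<integral>\<^sup>+z. ennreal (h (\<delta> x + z \<bullet> z)) \<partial>(lborel :: (real ^ 'p) measure)) / ennreal (sqrt (det (mat11 \<Omega>)))"
proof -
  note [measurable] = meas
  define F where "F u = ennreal (h (max 0 u))" for u
  have [measurable]: "F \<in> borel_measurable borel" unfolding F_def by measurable
  let ?c = "vec2 \<xi> + mat21 \<Omega> *v (matrix_inv (mat11 \<Omega>) *v (x - vec1 \<xi>))"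
  let ?a = "sqrt (det (mat11 \<Omega>))" and ?s = "sqrt (det (schur \<Omega>))"
  have pos: "0 < ?a" "0 < ?s"
    using det_pos_def_matrix[OF S] det_pos_def_matrix[OF pos_def_mat11[OF \<Omega>]] by simp_all
  have \<delta>: "0 \<le> \<delta> x"
    unfolding \<delta>_def by (intro pos_def_matrix_nonneg pos_def_matrix_inv pos_def_mat11 \<Omega>)
  have "ennreal (EC_density \<xi> \<Omega> h (stack x y)) =
      F (\<delta> x + (y - ?c) \<bullet> (matrix_inv (schur \<Omega>) *v (y - ?c))) / ennreal (?a * ?s)" for y
  proof -
    have "0 \<le> \<delta> x + (y - ?c) \<bullet> (matrix_inv (schur \<Omega>) *v (y - ?c))"
      by (intro add_nonneg_nonneg \<delta> pos_def_matrix_nonneg pos_def_matrix_inv S)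
    then show ?thesis
      unfolding EC_density_stack[OF \<Omega> S] F_def \<delta>_def[symmetric]
      using h pos by (simp add: divide_ennreal)
  qed
  then have "(\<integral>\<^sup>+y. ennreal (EC_density \<xi> \<Omega> h (stack x y)) \<partial>lborel) =
     (\<integral>\<^sup>+y. F (\<delta> x + (y - ?c) \<bullet> (matrix_inv (schur \<Omega>) *v (y - ?c))) \<partial>lborel) / ennreal (?a * ?s)"
    by (simp add: nn_integral_divide)
  also have "\<dots> = ennreal ?s * (\<integral>\<^sup>+z. F (\<delta> x + z \<bullet> z) \<partial>(lborel :: (real ^ 'p) measure)) / ennreal (?a * ?s)"
    by (subst nn_integral_shifted_quadratic_form[OF S]) simp_all
  also have "\<dots> = (\<integral>\<^sup>+z. F (\<delta> x + z \<bullet> z) \<partial>(lborel :: (real ^ 'p) measure)) / ennreal ?a"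
  proof -
    have "ennreal ?s * inverse (ennreal (?a * ?s)) = inverse (ennreal ?a)"
      using pos by (simp add: inverse_ennreal ennreal_mult[symmetric] del: ennreal_mult'')
    then show ?thesis
      unfolding divide_ennreal_def by (simp only: mult.commute[of "ennreal ?s"] mult.assoc)
  qed
  also have "(\<integral>\<^sup>+z. F (\<delta> x + z \<bullet> z) \<partial>(lborel :: (real ^ 'p) measure)) =
      (\<integral>\<^sup>+z. ennreal (h (\<delta> x + z \<bullet> z)) \<partial>(lborel :: (real ^ 'p) measure))"
    using \<delta> by (intro nn_integral_cong) (simp add: F_def)
  finally show ?thesis .
qed

text \<open>A divergent integral gives \<open>0\<close> on both sides.\<close>

lemma marginal_generator_eq_nn_integral:
  assumes h: "\<forall>u\<ge>0. 0 \<le> h u" and [measurable]: "(\<lambda>u. h (max 0 u)) \<in> borel_measurable borel"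
    and u: "0 \<le> u"
  shows "marginal_generator TYPE('p::finite) h u =
    enn2real (\<integral>\<^sup>+z. ennreal (h (u + z \<bullet> z)) \<partial>(lborel :: (real ^ 'p) measure))"
proof -
  have "(\<lambda>z::real^'p. h (u + z \<bullet> z)) = (\<lambda>z. h (max 0 (u + z \<bullet> z)))"
    using u by simp
  also have "\<dots> \<in> borel_measurable lborel" by measurable
  finally show ?thesis
    unfolding marginal_generator_def using h u by (intro integral_eq_nn_integral) auto
qed

lemma elliptical_marginal:
  fixes \<Omega> :: "real ^ ('q::finite + 'p::finite) ^ ('q + 'p)"
  assumes X: "elliptical M X \<xi> \<Omega> h" and S: "pos_def_matrix (schur \<Omega>)"
  shows "elliptical M (\<lambda>\<omega>. vec1 (X \<omega>)) (vec1 \<xi>) (mat11 \<Omega>) (marginal_generator TYPE('p) h)"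
proof -
  let ?hq = "marginal_generator TYPE('p) h"
  let ?f = "\<lambda>x. ennreal (EC_density \<xi> \<Omega> h x)"
  let ?f1 = "\<lambda>x. ennreal (EC_density (vec1 \<xi>) (mat11 \<Omega>) ?hq x)"
  from X have \<Omega>: "pos_def_matrix \<Omega>" and h: "\<forall>u\<ge>0. 0 \<le> h u" and "prob_space M"
    and dist: "distributed M lborel X ?f"
    by (auto simp: elliptical_def)
  interpret prob_space M by fact
  have [measurable]: "X \<in> borel_measurable M" "?f \<in> borel_measurable borel"
    and distr_X: "distr M lborel X = density lborel ?f"
    using dist by (auto simp: distributed_def)
  note meas [measurable] = borel_measurable_generator[OF \<Omega> h \<open>?f \<in> borel_measurable borel\<close>]
  note A = pos_def_mat11[OF \<Omega>]
  let ?\<delta> = "\<lambda>x. (x - vec1 \<xi>) \<bullet> (matrix_inv (mat11 \<Omega>) *v (x - vec1 \<xi>))"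
  let ?I = "\<lambda>x. \<integral>\<^sup>+z. ennreal (h (?\<delta> x + z \<bullet> z)) \<partial>(lborel :: (real ^ 'p) measure)"
  have \<delta>: "0 \<le> ?\<delta> x" for x
    by (intro pos_def_matrix_nonneg pos_def_matrix_inv A)
  have a: "0 < sqrt (det (mat11 \<Omega>))"
    using det_pos_def_matrix[OF A] by simp
  have f1: "EC_density (vec1 \<xi>) (mat11 \<Omega>) ?hq x = enn2real (?I x) / sqrt (det (mat11 \<Omega>))" for x
    unfolding EC_density_def by (simp only: marginal_generator_eq_nn_integral[OF h meas \<delta>])
  have "?I = (\<lambda>x. \<integral>\<^sup>+z. ennreal (h (max 0 (?\<delta> x + z \<bullet> z))) \<partial>(lborel :: (real ^ 'p) measure))"
    using \<delta> by simp
  also have "\<dots> \<in> borel_measurable borel"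
    by measurable
  finally have [measurable]: "?I \<in> borel_measurable borel" .
  have [measurable]: "?f1 \<in> borel_measurable borel"
    unfolding f1 by measurable
  have total: "(\<integral>\<^sup>+x. (\<integral>\<^sup>+y. ?f (stack x y) \<partial>lborel) \<partial>lborel) = 1"
  proof -
    have "(\<integral>\<^sup>+x. (\<integral>\<^sup>+y. ?f (stack x y) \<partial>lborel) \<partial>lborel) = emeasure (density lborel ?f) UNIV"
      by (simp add: emeasure_density nn_integral_lborel_stack(1))
    also have "\<dots> = emeasure M (X -` UNIV \<inter> space M)"
      unfolding distr_X[symmetric] by (subst emeasure_distr) auto
    finally show ?thesis by (simp add: emeasure_space_1)
  qed
  \<comment> \<open>Where the section integral is infinite, \<open>marginal_generator\<close> takes
    its default value \<open>0\<close> and the two sides differ; total mass \<open>1\<close>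
    confines this to a null set.\<close>
  have sec: "AE x in lborel. (\<integral>\<^sup>+y. ?f (stack x y) \<partial>lborel) = ?f1 x"
  proof -
    have "AE x in lborel. (\<integral>\<^sup>+y. ?f (stack x y) \<partial>lborel) \<noteq> \<infinity>"
      using total by (intro nn_integral_PInf_AE) auto
    then show ?thesis
    proof eventually_elim
      case (elim x)
      then have "?I x \<noteq> \<top>"
        using a unfolding nn_integral_EC_density_section[OF \<Omega> S h meas]
        by (auto simp: ennreal_top_divide)
      then show ?case
        using a unfolding nn_integral_EC_density_section[OF \<Omega> S h meas] f1
        by (simp add: divide_ennreal[symmetric] ennreal_enn2real_if)
    qed
  qed
  have "distr M lborel (\<lambda>\<omega>. vec1 (X \<omega>)) = density lborel ?f1"
  proof (rule measure_eqI)
    fix B assume "B \<in> sets (distr M lborel (\<lambda>\<omega>. vec1 (X \<omega>)))"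
    then have [measurable]: "B \<in> sets borel" by simp
    have "emeasure (distr M lborel (\<lambda>\<omega>. vec1 (X \<omega>))) B = emeasure (distr M lborel X) (vec1 -` B)"
      using measurable_sets_borel[OF borel_measurable_subvec, of B]
      by (simp add: emeasure_distr vimage_def)
    also have "\<dots> = (\<integral>\<^sup>+w. ?f w * indicator B (vec1 w) \<partial>lborel)"
      unfolding distr_X using measurable_sets_borel[OF borel_measurable_subvec, of B]
      by (subst emeasure_density) (auto intro!: nn_integral_cong simp: indicator_def)
    also have "\<dots> = (\<integral>\<^sup>+x. (\<integral>\<^sup>+y. ?f (stack x y) * indicator B x \<partial>lborel) \<partial>lborel)"
      by (subst nn_integral_lborel_stack(1)) simp_all
    also have "\<dots> = (\<integral>\<^sup>+x. (\<integral>\<^sup>+y. ?f (stack x y) \<partial>lborel) * indicator B x \<partial>lborel)"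
      by (simp add: nn_integral_multc)
    also have "\<dots> = (\<integral>\<^sup>+x. ?f1 x * indicator B x \<partial>lborel)"
      using sec by (intro nn_integral_cong_AE) auto
    also have "\<dots> = emeasure (density lborel ?f1) B"
      by (simp add: emeasure_density)
    finally show "emeasure (distr M lborel (\<lambda>\<omega>. vec1 (X \<omega>))) B = emeasure (density lborel ?f1) B" .
  qed simp
  moreover have "0 \<le> ?hq u" if "0 \<le> u" for u
    using that h by (simp add: marginal_generator_def)
  ultimately show ?thesis
    using A prob_space_axioms by (auto simp: elliptical_def distributed_def)
qed

section \<open>Selection laws and conditioning on events\<close>

lemma SLCT_EC_eq_density:
  fixes \<Omega> :: "real ^ ('q::finite + 'p::finite) ^ ('q + 'p)"
  assumes [measurable]: "EC_density \<xi> \<Omega> h \<in> borel_measurable borel" "C \<in> sets borel"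
    and C: "emeasure (EC \<xi> \<Omega> h) {x. vec1 x \<in> C} \<noteq> 0"
  shows "SLCT_EC \<xi> \<Omega> h C = density lborel (\<lambda>y.
    (\<integral>\<^sup>+x. ennreal (EC_density \<xi> \<Omega> h (stack x y)) * indicator C x \<partial>lborel) /
    emeasure (EC \<xi> \<Omega> h) {x. vec1 x \<in> C})"
proof (rule measure_eqI)
  let ?A = "{x. vec1 x \<in> C}"
  have [measurable]: "?A \<in> sets borel"
    using measurable_sets_borel[OF borel_measurable_subvec assms(2)] by (simp add: vimage_def)
  fix B assume "B \<in> sets (SLCT_EC \<xi> \<Omega> h C)"
  then have [measurable]: "B \<in> sets borel" by (simp add: SLCT_EC_def)
  have [measurable]: "vec2 -` B \<in> sets borel"
    using measurable_sets_borel[OF borel_measurable_subvec, of B] by simp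
  have "emeasure (SLCT_EC \<xi> \<Omega> h C) B = emeasure (uniform_measure (EC \<xi> \<Omega> h) ?A) (vec2 -` B)"
    unfolding SLCT_EC_def by (subst emeasure_distr) (simp_all add: EC_def)
  also have "\<dots> = emeasure (EC \<xi> \<Omega> h) (?A \<inter> vec2 -` B) / emeasure (EC \<xi> \<Omega> h) ?A"
    by (rule emeasure_uniform_measure) (simp_all add: EC_def)
  also have "emeasure (EC \<xi> \<Omega> h) (?A \<inter> vec2 -` B) =
      (\<integral>\<^sup>+w. ennreal (EC_density \<xi> \<Omega> h w) * indicator C (vec1 w) * indicator B (vec2 w) \<partial>lborel)"
    unfolding EC_def by (subst emeasure_density) (auto intro!: nn_integral_cong simp: indicator_def)
  also have "\<dots> = (\<integral>\<^sup>+y. (\<integral>\<^sup>+x. ennreal (EC_density \<xi> \<Omega> h (stack x y)) * indicator C x * indicator B y \<partial>lborel) \<partial>lborel)"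
    by (subst nn_integral_lborel_stack(2)) simp_all
  also have "\<dots> = (\<integral>\<^sup>+y. (\<integral>\<^sup>+x. ennreal (EC_density \<xi> \<Omega> h (stack x y)) * indicator C x \<partial>lborel) * indicator B y \<partial>lborel)"
    by (simp add: nn_integral_multc)
  also have "\<dots> / emeasure (EC \<xi> \<Omega> h) ?A = (\<integral>\<^sup>+y. (\<integral>\<^sup>+x. ennreal (EC_density \<xi> \<Omega> h (stack x y)) * indicator C x \<partial>lborel) *
      indicator B y / emeasure (EC \<xi> \<Omega> h) ?A \<partial>lborel)"
    by (rule nn_integral_divide[symmetric]) measurable
  also have "\<dots> = (\<integral>\<^sup>+y. (\<integral>\<^sup>+x. ennreal (EC_density \<xi> \<Omega> h (stack x y)) * indicator C x \<partial>lborel) /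
      emeasure (EC \<xi> \<Omega> h) ?A * indicator B y \<partial>lborel)"
    by (simp add: divide_ennreal_def mult_ac)
  finally show "emeasure (SLCT_EC \<xi> \<Omega> h C) B = emeasure (density lborel (\<lambda>y.
    (\<integral>\<^sup>+x. ennreal (EC_density \<xi> \<Omega> h (stack x y)) * indicator C x \<partial>lborel) /
    emeasure (EC \<xi> \<Omega> h) ?A)) B"
    by (simp add: emeasure_density)
qed (simp add: SLCT_EC_def)

lemma integral_uniform_measure:
  fixes f :: "'a \<Rightarrow> real"
  assumes "finite_measure N" and [measurable]: "A \<in> sets N" "f \<in> borel_measurable N"
    and A: "measure N A \<noteq> 0"
  shows "(\<integral>x. f x \<partial>uniform_measure N A) = (\<integral>x. indicator A x * f x \<partial>N) / measure N A"
proof -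
  interpret finite_measure N by fact
  have "0 < measure N A" using A by (simp add: zero_less_measure_iff)
  then have "uniform_measure N A = density N (\<lambda>x. ennreal (indicator A x / measure N A))"
    unfolding uniform_measure_def
    by (auto intro!: density_cong simp: emeasure_eq_measure divide_ennreal[symmetric] ennreal_indicator)
  then have "(\<integral>x. f x \<partial>uniform_measure N A) = (\<integral>x. (indicator A x / measure N A) * f x \<partial>N)"
    by (simp add: integral_density)
  then show ?thesis by simp
qed

lemma borel_measurable_vec_nth [measurable (raw)]:
  fixes f :: "'a \<Rightarrow> real ^ 'n"
  assumes [measurable]: "f \<in> borel_measurable M"
  shows "(\<lambda>x. f x $ i) \<in> borel_measurable M"
  by (rule measurable_compose[OF assms borel_measurable_continuous_onI])
     (intro continuous_intros)

lemma sets_ebox [measurable]: "ebox a b \<in> sets borel"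
  unfolding ebox_def by measurable

lemma sets_pos_orthant [measurable]: "pos_orthant \<in> sets borel"
  unfolding pos_orthant_def by measurable

lemma emeasure_pos_orthant: "emeasure lborel (pos_orthant :: (real ^ 'q) set) \<noteq> 0"
proof -
  let ?B = "box 0 (\<chi> i. 1) :: (real ^ 'q) set"
  have "emeasure lborel ?B \<le> emeasure lborel (pos_orthant :: (real ^ 'q) set)"
    by (intro emeasure_mono) (auto simp: mem_box_cart pos_orthant_def)
  moreover have "emeasure lborel ?B = 1"
    by (subst emeasure_lborel_box_cart) simp_all
  ultimately show ?thesis by auto
qed

lemma AE_lborel_nth_nonzero: "AE x in (lborel :: (real ^ 'n) measure). x $ i \<noteq> 0"
proof -
  have "{x :: real ^ 'n. x $ i = 0} \<in> null_sets lborel"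
    using negligible_standard_hyperplane_cart[of i]
    by (subst null_sets_completion_iff[symmetric]) (simp_all add: negligible_iff_null_sets)
  then show ?thesis by (rule AE_I') auto
qed


theorem lemma1:
  fixes M :: "'m measure" and MY :: "'my measure" and MY0 :: "'my0 measure"
    and MW :: "'mw measure" and MW0 :: "'mw0 measure"
    and X :: "'m \<Rightarrow> real ^ ('q::finite + 'p::finite)"
    and Y :: "'my \<Rightarrow> real ^ 'p" and Y0 :: "'my0 \<Rightarrow> real ^ 'p"
    and W :: "'mw \<Rightarrow> real ^ 'p" and W0 :: "'mw0 \<Rightarrow> real ^ 'p"
    and \<xi> :: "real ^ ('q + 'p)" and \<Omega> :: "real ^ ('q + 'p) ^ ('q + 'p)"
    and h hq h0 :: "real \<Rightarrow> real" and \<delta>1 :: real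
    and a b :: "ereal ^ 'p" and g :: "real ^ 'p \<Rightarrow> real"
    and f :: "real ^ ('q + 'p) \<Rightarrow> real" and fX1 :: "real ^ 'q \<Rightarrow> real"
  assumes X: "elliptical M X \<xi> \<Omega> h"
    and f: "f = EC_density \<xi> \<Omega> h"
    and hq: "hq = marginal_generator TYPE('p) h"
    and fX1: "fX1 = EC_density (vec1 \<xi>) (mat11 \<Omega>) hq"
    and \<delta>1: "\<delta>1 = vec1 \<xi> \<bullet> (matrix_inv (mat11 \<Omega>) *v vec1 \<xi>)"
    and h0: "h0 = conditional_generator h hq \<delta>1"
    and Y: "has_law MY Y (TSLCT_EC \<xi> \<Omega> h pos_orthant a b)"
    and Y0: "has_law MY0 Y0 (SLCT_EC \<xi> \<Omega> h pos_orthant)"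
    and W0: "elliptical MW0 W0
               (vec2 \<xi> - mat21 \<Omega> *v (matrix_inv (mat11 \<Omega>) *v vec1 \<xi>))
               (mat22 \<Omega> - mat21 \<Omega> ** matrix_inv (mat11 \<Omega>) ** mat12 \<Omega>) h0"
    and W: "has_law MW W (uniform_measure (distr MW0 borel W0) (ebox a b))"
    and pos_X1: "\<P>(\<omega> in M. vec1 (X \<omega>) \<in> pos_orthant) > 0"
    and pos_Y0: "\<P>(\<omega> in MY0. Y0 \<omega> \<in> ebox a b) > 0"
    and pos_W0: "\<P>(\<omega> in MW0. W0 \<omega> \<in> ebox a b) > 0"
    and fX1_pos: "fX1 0 > 0"
    and g: "g \<in> borel_measurable borel"
    and int_Y: "integrable MY (\<lambda>\<omega>. g (Y \<omega>) *
                  (cond_density1 f (Y \<omega>) 0 / cond_prob1 f (Y \<omega>) pos_orthant))"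
    and int_W: "integrable MW (\<lambda>\<omega>. g (W \<omega>))"
  shows "elliptical M (\<lambda>\<omega>. vec1 (X \<omega>)) (vec1 \<xi>) (mat11 \<Omega>) hq \<and>
         (\<integral>\<omega>. g (Y \<omega>) * (cond_density1 f (Y \<omega>) 0 / cond_prob1 f (Y \<omega>) pos_orthant) \<partial>MY) =
         \<P>(\<omega> in MW0. W0 \<omega> \<in> ebox a b) / \<P>(\<omega> in MY0. Y0 \<omega> \<in> ebox a b) *
         ((\<integral>\<omega>. g (W \<omega>) \<partial>MW) / \<P>(\<omega> in M. \<forall>i. 0 \<le> vec1 (X \<omega>) $ i)) * fX1 0"
proof (rule conjI)
  let ?S = "schur \<Omega>" and ?C = "pos_orthant :: (real ^ 'q) set" and ?box = "ebox a b"
  let ?ind = "indicator ?box :: real ^ 'p \<Rightarrow> real"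
  from X have \<Omega>: "pos_def_matrix \<Omega>" and h: "\<forall>u\<ge>0. 0 \<le> h u" and "prob_space M"
    and dist: "distributed M lborel X (\<lambda>x. ennreal (f x))"
    by (auto simp: elliptical_def f)
  \<comment> \<open>The lemmas above on the Schur complement obtain their positive definiteness
    hypothesis here, from the elliptical law of \<open>W0\<close>.\<close>
  from W0 have S: "pos_def_matrix ?S" and h0_nonneg: "\<forall>u\<ge>0. 0 \<le> h0 u" and "prob_space MW0"
    and dist0: "distributed MW0 lborel W0 (\<lambda>y. ennreal (EC_density
      (vec2 \<xi> - mat21 \<Omega> *v (matrix_inv (mat11 \<Omega>) *v vec1 \<xi>)) ?S h0 y))"
    by (auto simp: elliptical_def)
  show "elliptical M (\<lambda>\<omega>. vec1 (X \<omega>)) (vec1 \<xi>) (mat11 \<Omega>) hq"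
    unfolding hq by (rule elliptical_marginal[OF X S])
  interpret M: prob_space M by fact
  interpret MW0: prob_space MW0 by fact
  interpret MY0: prob_space MY0 using Y0 by (simp add: has_law_def)
  interpret MY: prob_space MY using Y by (simp add: has_law_def)
  interpret MW: prob_space MW using W by (simp add: has_law_def)
  have [measurable]: "X \<in> borel_measurable M" "W0 \<in> borel_measurable MW0"
    "Y \<in> borel_measurable MY" "Y0 \<in> borel_measurable MY0" "W \<in> borel_measurable MW"
    "(\<lambda>x. ennreal (f x)) \<in> borel_measurable borel"
    using dist dist0 Y Y0 W by (auto simp: distributed_def has_law_def)
  note [measurable] = g
  have f_nonneg: "0 \<le> f x" for x
    unfolding f by (rule EC_density_nonneg[OF \<Omega> h])
  have meas_h [measurable]: "(\<lambda>u. h (max 0 u)) \<in> borel_measurable borel"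
    using \<open>(\<lambda>x. ennreal (f x)) \<in> borel_measurable borel\<close>
    unfolding f by (rule borel_measurable_generator[OF \<Omega> h])
  have "f = (\<lambda>x. enn2real (ennreal (f x)))"
    using f_nonneg by simp
  also have "\<dots> \<in> borel_measurable borel" by measurable
  finally have [measurable]: "f \<in> borel_measurable borel" .

  have EC: "EC \<xi> \<Omega> h = density lborel (\<lambda>x. ennreal (f x))"
    by (simp add: EC_def f)
  have law_X: "distr M lborel X = EC \<xi> \<Omega> h"
    using dist by (simp add: EC distributed_def)
  define pC where "pC = M.prob {\<omega>\<in>space M. vec1 (X \<omega>) \<in> ?C}"
  have "emeasure (EC \<xi> \<Omega> h) {x. vec1 x \<in> ?C} = emeasure M {\<omega>\<in>space M. vec1 (X \<omega>) \<in> ?C}"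
  proof -
    have "{x. vec1 x \<in> ?C} \<in> sets borel"
      using measurable_sets_borel[OF borel_measurable_subvec sets_pos_orthant] by (simp add: vimage_def)
    then show ?thesis
      unfolding law_X[symmetric]
      by (subst emeasure_distr) (auto intro!: arg_cong2[where f = emeasure])
  qed
  then have pC: "emeasure (EC \<xi> \<Omega> h) {x. vec1 x \<in> ?C} = ennreal pC" and pC_pos: "0 < pC"
    using pos_X1 by (simp_all add: M.emeasure_eq_measure pC_def)
  \<comment> \<open>The closed orthant adds only points on coordinate hyperplanes, which the
    absolutely continuous law of \<open>X\<close> does not charge.\<close>
  have pC_le: "\<P>(\<omega> in M. \<forall>i. 0 \<le> vec1 (X \<omega>) $ i) = pC"
  proof -
    have "AE x in lborel. \<forall>i::'q. vec1 x $ i \<noteq> 0"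
      unfolding AE_all_countable using AE_lborel_nth_nonzero by (auto simp: subvec_def)
    then have "AE x in distr M lborel X. \<forall>i::'q. vec1 x $ i \<noteq> 0"
      unfolding law_X EC by (subst AE_density) auto
    then have "AE \<omega> in M. \<forall>i::'q. vec1 (X \<omega>) $ i \<noteq> 0"
      by (rule AE_distrD[rotated]) simp
    then show ?thesis
      unfolding pC_def by (intro measure_eq_AE) (auto simp: pos_orthant_def less_le)
  qed

  define \<phi> where "\<phi> y = (\<integral>\<^sup>+x. ennreal (f (stack x y)) * indicator ?C x \<partial>lborel)" for y
  define \<psi> where "\<psi> y = (\<integral>\<^sup>+x. ennreal (f (stack x y)) \<partial>lborel)" for y
  have [measurable]: "\<phi> \<in> borel_measurable borel" "\<psi> \<in> borel_measurable borel"
    unfolding \<phi>_def \<psi>_def by measurable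
  have \<phi>_le: "\<phi> y \<le> \<psi> y" for y
    unfolding \<phi>_def \<psi>_def by (intro nn_integral_mono) (auto simp: indicator_def)
  have "(\<integral>\<^sup>+y. \<psi> y \<partial>lborel) = emeasure (EC \<xi> \<Omega> h) UNIV"
    unfolding \<psi>_def EC by (simp add: emeasure_density nn_integral_lborel_stack(2))
  also have "\<dots> = 1"
    unfolding law_X[symmetric] by (subst emeasure_distr) (auto simp: M.emeasure_space_1)
  finally have \<psi>_finite: "AE y in lborel. \<psi> y \<noteq> \<infinity>"
    by (intro nn_integral_PInf_AE) auto
  have \<phi>_pos: "AE y in lborel. f (stack 0 y) \<noteq> 0 \<longrightarrow> \<phi> y \<noteq> 0"
  proof -
    \<comment> \<open>Whether the density vanishes depends only on whether the value of the form
      lies in \<open>H\<close>. The clamp \<open>max 0\<close> makes \<open>H\<close> Borel and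
      changes nothing at values of the form, which are nonnegative.\<close>
    define H where "H = {u. h (max 0 u) \<noteq> 0}"
    have [measurable]: "H \<in> sets borel" unfolding H_def by measurable
    let ?Q = "\<lambda>x y. (stack x y - \<xi>) \<bullet> (matrix_inv \<Omega> *v (stack x y - \<xi>))"
    have "?Q x y = max 0 (?Q x y)" for x y
      using pos_def_matrix_nonneg[OF pos_def_matrix_inv[OF \<Omega>]] by simp
    then have fH: "f (stack x y) \<noteq> 0 \<longleftrightarrow> ?Q x y \<in> H" for x y
      using det_pos_def_matrix[OF \<Omega>] by (simp add: f EC_density_def H_def)
    have "AE y in lborel. ?Q 0 y \<in> H \<longrightarrow> emeasure lborel {x\<in>?C. ?Q x y \<in> H} \<noteq> 0"
      by (rule AE_section_not_null[OF \<Omega> S])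
         (use emeasure_pos_orthant in \<open>auto simp: pos_orthant_def\<close>)
    then show ?thesis
    proof eventually_elim
      case (elim y)
      show ?case
      proof (intro impI notI)
        assume "f (stack 0 y) \<noteq> 0" "\<phi> y = 0"
        then have "AE x in lborel. ennreal (f (stack x y)) * indicator ?C x = 0"
          unfolding \<phi>_def by (subst (asm) nn_integral_0_iff_AE) auto
        then have "AE x in lborel. x \<notin> {x\<in>?C. f (stack x y) \<noteq> 0}"
          using f_nonneg by (auto simp: indicator_def ennreal_eq_0_iff antisym)
        then have "{x\<in>?C. f (stack x y) \<noteq> 0} \<in> null_sets lborel"
          using AE_iff_null_sets[of "{x\<in>?C. f (stack x y) \<noteq> 0}" lborel] by simp
        then show False
          using elim \<open>f (stack 0 y) \<noteq> 0\<close> unfolding fH by (auto dest: null_setsD1)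
      qed
    qed
  qed

  define k where "k y = g y * (cond_density1 f y 0 / cond_prob1 f y ?C)" for y
  have marginal: "marginal_density2 f y = enn2real (\<psi> y)" for y
    unfolding marginal_density2_def \<psi>_def using f_nonneg
    by (intro integral_eq_nn_integral) auto
  have cond_prob: "cond_prob1 f y ?C = enn2real (\<phi> y) / enn2real (\<psi> y)" for y
  proof -
    have "cond_prob1 f y ?C = (\<integral>x. f (stack x y) * indicator ?C x \<partial>lborel) / enn2real (\<psi> y)"
      by (simp add: cond_prob1_def set_lebesgue_integral_def cond_density1_def marginal mult.commute)
    also have "(\<integral>x. f (stack x y) * indicator ?C x \<partial>lborel) = enn2real (\<phi> y)"
    proof -
      have "\<phi> y = (\<integral>\<^sup>+x. ennreal (f (stack x y) * indicator ?C x) \<partial>lborel)"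
        unfolding \<phi>_def by (intro nn_integral_cong) (auto simp: indicator_def)
      then show ?thesis
        using f_nonneg by (simp add: integral_eq_nn_integral)
    qed
    finally show ?thesis .
  qed
  have k_eq: "k y = g y * (f (stack 0 y) / enn2real (\<psi> y) / (enn2real (\<phi> y) / enn2real (\<psi> y)))" for y
    unfolding k_def cond_prob by (simp add: cond_density1_def marginal)
  have [measurable]: "k \<in> borel_measurable borel"
    unfolding k_eq[abs_def] by measurable
  \<comment> \<open>If \<open>f (stack 0 y) = 0\<close>, both sides vanish, even when a denominator
    is \<open>0\<close>. Otherwise \<open>\<phi> y\<close> and \<open>\<psi> y\<close> are nonzero
    and finite for almost every such \<open>y\<close>, so the marginal density \<open>\<psi>\<close>
    cancels first and \<open>\<phi>\<close> next.\<close>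
  have cancel: "AE y in lborel. enn2real (\<phi> y) * k y = g y * f (stack 0 y)"
    using \<psi>_finite \<phi>_pos
  proof eventually_elim
    case (elim y)
    show ?case
    proof (cases "f (stack 0 y) = 0")
      case False
      with elim have "\<phi> y \<noteq> 0" "\<psi> y \<noteq> 0" "\<phi> y \<noteq> \<top>" "\<psi> y \<noteq> \<top>"
        using \<phi>_le[of y] by (auto simp: top_unique)
      then show ?thesis
        by (simp add: k_eq enn2real_eq_0_iff)
    qed (simp add: k_eq)
  qed

  let ?N = "SLCT_EC \<xi> \<Omega> h ?C"
  define p0 where "p0 = MY0.prob {\<omega>\<in>space MY0. Y0 \<omega> \<in> ?box}"
  have law_Y0: "distr MY0 borel Y0 = ?N" using Y0 by (simp add: has_law_def)
  interpret N: prob_space ?N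
    unfolding law_Y0[symmetric] by (rule MY0.prob_space_distr) simp
  have sets_N: "sets ?N = sets borel" by (simp add: SLCT_EC_def)
  have p0: "measure ?N ?box = p0"
    unfolding law_Y0[symmetric] p0_def
    by (subst measure_distr) (auto intro!: arg_cong2[where f = measure])
  have "?N = density lborel (\<lambda>y. \<phi> y / ennreal pC)"
    unfolding pC[symmetric] \<phi>_def f
    by (rule SLCT_EC_eq_density)
       (use pC pC_pos \<open>f \<in> borel_measurable borel\<close> in \<open>auto simp: f\<close>)
  \<comment> \<open>\<open>integral_density\<close> needs a real density; \<open>enn2real\<close>
    alters \<open>\<phi>\<close> only where it is infinite, a null set since
    \<open>\<phi> \<le> \<psi>\<close>.\<close>
  also have "\<dots> = density lborel (\<lambda>y. ennreal (enn2real (\<phi> y) / pC))"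
  proof (rule density_cong)
    show "AE y in lborel. \<phi> y / ennreal pC = ennreal (enn2real (\<phi> y) / pC)"
      using \<psi>_finite
    proof eventually_elim
      case (elim y)
      then have "\<phi> y < \<top>" using \<phi>_le[of y] by (auto simp: less_top top_unique)
      then show ?case using pC_pos by (simp add: divide_ennreal[symmetric])
    qed
  qed measurable
  finally have N: "?N = \<dots>" .
  have "(\<integral>\<omega>. k (Y \<omega>) \<partial>MY) = (\<integral>y. k y \<partial>uniform_measure ?N ?box)"
  proof -
    have "distr MY borel Y = uniform_measure ?N ?box"
      using Y by (simp add: has_law_def TSLCT_EC_def)
    then show ?thesis by (subst integral_distr[symmetric, of Y MY borel]) simp_all
  qed
  also have "\<dots> = (\<integral>y. ?ind y * k y \<partial>?N) / p0"
    unfolding p0[symmetric] using pos_Y0 p0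
    by (intro integral_uniform_measure N.finite_measure_axioms)
       (auto simp: sets_N p0_def measurable_cong_sets[OF sets_N refl])
  also have "(\<integral>y. ?ind y * k y \<partial>?N) = (\<integral>y. enn2real (\<phi> y) / pC * (?ind y * k y) \<partial>lborel)"
    unfolding N using pC_pos by (subst integral_density) auto
  also have "\<dots> = (\<integral>y. ?ind y * (g y * f (stack 0 y)) / pC \<partial>lborel)"
  proof (rule integral_cong_AE)
    show "AE y in lborel. enn2real (\<phi> y) / pC * (?ind y * k y) = ?ind y * (g y * f (stack 0 y)) / pC"
      using cancel
    proof eventually_elim
      case (elim y)
      show ?case unfolding elim[symmetric] by simp
    qed
  qed measurable
  finally have lhs: "(\<integral>\<omega>. k (Y \<omega>) \<partial>MY) =
      (\<integral>y. ?ind y * (g y * f (stack 0 y)) \<partial>lborel) / pC / p0"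
    by simp

  define fW where "fW = EC_density (vec2 \<xi> - mat21 \<Omega> *v (matrix_inv (mat11 \<Omega>) *v vec1 \<xi>)) ?S h0"
  define pW where "pW = MW0.prob {\<omega>\<in>space MW0. W0 \<omega> \<in> ?box}"
  let ?L = "distr MW0 borel W0"
  have fW_nonneg: "0 \<le> fW y" for y
    unfolding fW_def by (rule EC_density_nonneg[OF S h0_nonneg])
  have law_W0: "?L = density lborel (\<lambda>y. ennreal (fW y))"
    using dist0 unfolding fW_def[symmetric] distributed_def by (metis distr_cong sets_lborel)
  have "(\<lambda>y. ennreal (fW y)) \<in> borel_measurable borel"
    using dist0 by (simp add: distributed_def fW_def)
  moreover have "fW = (\<lambda>y. enn2real (ennreal (fW y)))"
    using fW_nonneg by simp
  ultimately have [measurable]: "fW \<in> borel_measurable borel"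
    by (metis borel_measurable_enn2real)
  \<comment> \<open>The conditional generator divides by \<open>hq \<delta>1\<close>, and
    \<open>fX1 0\<close> restores this factor; \<open>fX1 0 > 0\<close> keeps it from being
    \<open>0\<close>. The determinants match by \<open>sqrt_det_schur\<close>.\<close>
  have factor: "fW y * fX1 0 = f (stack 0 y)" for y
  proof -
    note minus = linear_neg[OF matrix_vector_mul_linear]
    have fX1_0: "fX1 0 = hq \<delta>1 / sqrt (det (mat11 \<Omega>))"
      by (simp add: fX1 EC_density_def \<delta>1 minus)
    with fX1_pos have "hq \<delta>1 \<noteq> 0" by auto
    then show ?thesis
      unfolding f fX1_0 EC_density_stack[OF \<Omega> S]
      by (simp add: fW_def EC_density_def h0 conditional_generator_def \<delta>1 minus add.commute)
  qed
  interpret L: prob_space ?L by (rule MW0.prob_space_distr) simp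
  have pW: "measure ?L ?box = pW"
    unfolding pW_def by (subst measure_distr) (auto intro!: arg_cong2[where f = measure])
  have pW_pos: "0 < pW" using pos_W0 by (simp add: pW_def)
  have "(\<integral>\<omega>. g (W \<omega>) \<partial>MW) = (\<integral>y. g y \<partial>uniform_measure ?L ?box)"
  proof -
    have "distr MW borel W = uniform_measure ?L ?box"
      using W by (simp add: has_law_def)
    then show ?thesis by (subst integral_distr[symmetric, of W MW borel]) simp_all
  qed
  also have "\<dots> = (\<integral>y. ?ind y * g y \<partial>?L) / pW"
    unfolding pW[symmetric] using pW_pos pW
    by (intro integral_uniform_measure L.finite_measure_axioms) auto
  also have "(\<integral>y. ?ind y * g y \<partial>?L) = (\<integral>y. fW y * (?ind y * g y) \<partial>lborel)"
    unfolding law_W0 using fW_nonneg by (subst integral_density) auto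
  finally have "(\<integral>\<omega>. g (W \<omega>) \<partial>MW) * pW * fX1 0 = (\<integral>y. fW y * (?ind y * g y) * fX1 0 \<partial>lborel)"
    using pW_pos by simp
  also have "\<dots> = (\<integral>y. ?ind y * (g y * f (stack 0 y)) \<partial>lborel)"
    unfolding factor[symmetric] by (simp add: mult_ac)
  finally show "(\<integral>\<omega>. g (Y \<omega>) * (cond_density1 f (Y \<omega>) 0 / cond_prob1 f (Y \<omega>) pos_orthant) \<partial>MY) =
         \<P>(\<omega> in MW0. W0 \<omega> \<in> ebox a b) / \<P>(\<omega> in MY0. Y0 \<omega> \<in> ebox a b) *
         ((\<integral>\<omega>. g (W \<omega>) \<partial>MW) / \<P>(\<omega> in M. \<forall>i. 0 \<le> vec1 (X \<omega>) $ i)) * fX1 0"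
    unfolding pC_le k_def[symmetric] lhs pW_def[symmetric] p0_def[symmetric]
    by (simp add: mult_ac)
qed

end
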